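(* Let $k\ge 3$ be a fixed integer, and let $\kappa=\kappa(k)=1$ if $k\ge 4$ and $\kappa(3)=1/2$. Let $d=d(n)$ satisfy $1\le d=o(n^{\kappa})$ (with $k \mid nd$). Then, as $n\to\infty$, \[ |\mathcal{H}^{(k)}(n,d)| = \frac{(nd)!}{(nd/k)!\,(k!)^{nd/k}\,(d!)^n}\exp\left\{-\tfrac12(k-1)(d-1)+O\left((d/n)^{1/2}+d^2/n\right)\right\}. \]
   Context: A $k$-uniform hypergraph ($k$-graph) on vertex set $[n]=\{1,\dots,n\}$ is a set of $k$-element subsets of $[n]$ (edges). It is $d$-regular if every vertex lies in exactly $d$ edges. $\mathcal{H}^{(k)}(n,d)$ denotes the set of all $d$-regular $k$-graphs on $[n]$; throughout it is implicitly assumed that $k$ divides $nd$. Here $d=d(n)$ is a function of $n$ (possibly constant). *)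

theory Defs
  imports Complex_Main "HOL-Library.Landau_Symbols"
begin

definition uniform_hypergraph :: "nat \<Rightarrow> 'a set \<Rightarrow> 'a set set \<Rightarrow> bool" where
  "uniform_hypergraph k V E \<longleftrightarrow> (\<forall>e\<in>E. e \<subseteq> V \<and> card e = k)"

definition regular_hypergraph :: "nat \<Rightarrow> 'a set \<Rightarrow> 'a set set \<Rightarrow> bool" where
  "regular_hypergraph d V E \<longleftrightarrow> (\<forall>v\<in>V. card {e \<in> E. v \<in> e} = d)"

definition regular_hypergraphs :: "nat \<Rightarrow> nat \<Rightarrow> nat \<Rightarrow> nat set set set" where
  "regular_hypergraphs k n d =
     {E. uniform_hypergraph k {1..n} E \<and> regular_hypergraph d {1..n} E}"

(* Only used for k >= 3. *)
definition kappa :: "nat \<Rightarrow> real" where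
  "kappa k = (if k \<ge> 4 then 1 else 1/2)"

(* For a fixed (e.g. constant) degree function d, the condition "k divides n d(n)" may hold only
   for some n; n tends to infinity through these values. *)
definition admissible_at_top :: "nat \<Rightarrow> (nat \<Rightarrow> nat) \<Rightarrow> nat filter" where
  "admissible_at_top k d = inf at_top (principal {n. k dvd n * d n})"

end

theory Submission
  imports Defs "HOL-Library.FuncSet" "HOL-Library.Disjoint_Sets"
begin

text \<open>In the configuration model, distribute the \<open>n d\<close> points (\<open>d\<close> copies of each vertex) uniformly
  among \<open>M = n d / k\<close> blocks of \<open>k\<close> positions. A regular hypergraph arises from exactly
  \<open>M! (k!)^M (d!)^n\<close> of the \<open>(n d)!\<close> configurations, so the claim is an estimate for the probability
  that no block contains a vertex twice (a loop) and no two blocks coincide. Let \<open>a l\<close> be the number of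
  configurations with distinct blocks and exactly \<open>l\<close> loops, in different blocks.

  Exchanging the two ends of a loop with points of two distant blocks is a switching between
  the classes \<open>l\<close> and \<open>l - 1\<close>. Counting switchings from both sides gives
  \<open>l a l = x (1 + O(l / (n d) + d / n)) a (l - 1)\<close> where \<open>x = (k - 1) (d - 1) / 2\<close>. First moments show that
  up to a proportion \<open>O(sqrt (d / n) + d^2 / n^(k - 2))\<close> every configuration lies in a class
  with \<open>l \<le> L = sqrt (n d)\<close>. Hence \<open>(n d)!\<close> is, up to admissible errors, \<open>a 0\<close> times the partial sum
  up to \<open>L\<close> of the series of \<open>exp x\<close>, whose tail is small by Markov's inequality.\<close>

subsection \<open>Counting bijections\<close>

text \<open>Simple configurations may form only a proportion near exp(-x) of all, with x unbounded,
  so a discarded set need not be small compared with \<open>a 0\<close>. It is compared with the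
  total \<open>(n d)!\<close> instead: the classes up to \<open>L\<close> nearly exhaust the total,
  and \<open>a 0\<close> is recovered from their sum through the ratios. This is why first moments
  suffice. The obstacle to switching is that the exchanged points may produce further loops or
  coinciding blocks. Requiring that no block meets both of two affected blocks prevents this. It
  forbids O(d^2) blocks out of M, a relative error O(d / n) per ratio, and in the exponent this
  becomes x d / n = O(d^2 / n). The term (d / n)^(1/2) comes from truncating at \<open>L\<close>.
  Coinciding blocks are never switched away, only discarded. Their proportion, of order d^2 / n^(k -
  2), has to be small, which for k = 3 means d = o(n^(1/2)): the origin of
  \<open>kappa 3\<close>.\<close>

definition bijections :: "'a set \<Rightarrow> 'b set \<Rightarrow> ('a \<Rightarrow> 'b) set" where
  "bijections A B = {f \<in> A \<rightarrow>\<^sub>E B. bij_betw f A B}"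

lemma finite_bijections: "finite A \<Longrightarrow> finite B \<Longrightarrow> finite (bijections A B)"
  unfolding bijections_def by (simp add: finite_PiE)

lemma card_bijections:
  assumes "finite A" "finite B" "card A = card B"
  shows "card (bijections A B) = fact (card A)"
proof -
  have "bijections A B = {f \<in> A \<rightarrow>\<^sub>E B. inj_on f A}"
    unfolding bijections_def bij_betw_def
    using assms by (fastforce simp: PiE_iff card_image image_subset_iff dest: card_subset_eq[of B "_ ` A"])
  then show ?thesis
    using card_inj_on_subset_funcset[of A B A] assms
    by (simp add: fact_prod_rev)
qed

text \<open>A map on a disjoint union is a family of maps on the pieces. It is applied to the fibres
  of a word, to count labellings by copies, and to the blocks, to count orderings of the edges. Only
  the sources are disjoint: the targets \<open>B i\<close> may overlap, as edges do.\<close>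

lemma card_fibrewise_bijections:
  assumes "finite I" "\<And>i. i \<in> I \<Longrightarrow> finite (A i)" "\<And>i. i \<in> I \<Longrightarrow> finite (B i)"
    and "\<And>i. i \<in> I \<Longrightarrow> card (A i) = card (B i)" "disjoint_family_on A I"
  shows "card {f \<in> extensional (\<Union>i\<in>I. A i). \<forall>i\<in>I. bij_betw f (A i) (B i)} = (\<Prod>i\<in>I. fact (card (A i)))"
proof -
  let ?F = "{f \<in> extensional (\<Union>i\<in>I. A i). \<forall>i\<in>I. bij_betw f (A i) (B i)}"
  let ?G = "Pi\<^sub>E I (\<lambda>i. bijections (A i) (B i))"
  let ?h = "\<lambda>f. \<lambda>i\<in>I. restrict f (A i)"
  have "bij_betw ?h ?F ?G"
  proof (rule bij_betwI')
    fix f g assume f: "f \<in> ?F" and g: "g \<in> ?F"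
    show "(?h f = ?h g) = (f = g)"
    proof
      assume eq: "?h f = ?h g"
      show "f = g"
      proof (rule extensionalityI)
        fix x assume "x \<in> (\<Union>i\<in>I. A i)"
        then obtain i where i: "i \<in> I" "x \<in> A i" by auto
        then have "?h f i x = ?h g i x" using eq by simp
        then show "f x = g x" using i by simp
      qed (use f g in auto)
    qed simp
  next
    fix f assume "f \<in> ?F"
    then show "?h f \<in> ?G"
      by (auto simp: bijections_def bij_betw_def inj_on_def) blast+
  next
    fix g assume g: "g \<in> ?G"
    define f where "f = restrict (\<lambda>x. g (THE i. i \<in> I \<and> x \<in> A i) x) (\<Union>i\<in>I. A i)"
    have fx: "f x = g i x" if "i \<in> I" "x \<in> A i" for i x
    proof -
      have "(THE i. i \<in> I \<and> x \<in> A i) = i"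
        using that assms(5) by (intro the_equality) (auto simp: disjoint_family_on_def)
      then show ?thesis using that by (auto simp: f_def)
    qed
    have "f \<in> ?F"
    proof -
      have "bij_betw f (A i) (B i)" if "i \<in> I" for i
        using g that fx by (subst bij_betw_cong[where g = "g i"]) (auto simp: bijections_def PiE_iff)
      then show ?thesis by (auto simp: f_def)
    qed
    moreover have "?h f = g"
    proof (rule extensionalityI[of _ I])
      show "?h f i = g i" if i: "i \<in> I" for i
      proof -
        have "g i \<in> extensional (A i)" using g i by (auto simp: bijections_def PiE_iff)
        then show ?thesis using i fx by (auto intro!: extensionalityI[of _ "A i"])
      qed
    qed (use g in \<open>auto simp: PiE_iff\<close>)
    ultimately show "\<exists>f\<in>?F. g = ?h f" by auto
  qed
  then have "card ?F = card ?G" by (rule bij_betw_same_card)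
  also have "\<dots> = (\<Prod>i\<in>I. fact (card (A i)))"
    using assms by (simp add: card_PiE card_bijections cong: prod.cong)
  finally show ?thesis .
qed

text \<open>One code \<open>c\<close> names a switching and its inverse: since \<open>g c\<close>
  undoes itself, \<open>(s, c) \<mapsto> (g c s, c)\<close> is injective. The sets
  \<open>D t\<close> may overcount, so validity is checked in one direction only; each ratio is then
  bounded by two separate counts.\<close>

lemma double_counting_le:
  fixes u v :: nat
  assumes "finite S" "finite T"
    and "\<And>s. s \<in> S \<Longrightarrow> finite (C s) \<and> u \<le> card (C s)"
    and "\<And>t. t \<in> T \<Longrightarrow> finite (D t) \<and> card (D t) \<le> v"
    and "\<And>s c. s \<in> S \<Longrightarrow> c \<in> C s \<Longrightarrow> g c s \<in> T \<and> c \<in> D (g c s) \<and> g c (g c s) = s"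
  shows "u * card S \<le> v * card T"
proof -
  let ?h = "\<lambda>(s, c). (g c s, c)"
  have "u * card S \<le> (\<Sum>s\<in>S. card (C s))"
    using sum_bounded_below[of S u "\<lambda>s. card (C s)"] assms by (simp add: mult.commute)
  also have "\<dots> = card (Sigma S C)"
    using assms by (subst card_SigmaI) auto
  also have "\<dots> \<le> card (Sigma T D)"
  proof (rule card_inj_on_le[of ?h])
    show "inj_on ?h (Sigma S C)"
      using assms(5) by (intro inj_onI) (clarsimp, metis)
    show "?h ` Sigma S C \<subseteq> Sigma T D" using assms(5) by auto
    show "finite (Sigma T D)" using assms by auto
  qed
  also have "\<dots> = (\<Sum>t\<in>T. card (D t))"
    using assms by (subst card_SigmaI) auto
  also have "\<dots> \<le> v * card T"
    using sum_bounded_above[of T "\<lambda>t. card (D t)" v] assms by (simp add: mult.commute)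
  finally show ?thesis .
qed

definition swap_at :: "'a \<Rightarrow> 'a \<Rightarrow> ('a \<Rightarrow> 'b) \<Rightarrow> 'a \<Rightarrow> 'b" where
  "swap_at a b f = f(a := f b, b := f a)"

lemma swap_at_involutive [simp]: "swap_at a b (swap_at a b f) = f"
  by (auto simp: swap_at_def)

lemma swap_at_bijections:
  assumes "f \<in> bijections A B" "a \<in> A" "b \<in> A"
  shows "swap_at a b f \<in> bijections A B"
proof -
  have "inj_on (swap_at a b f) A" "swap_at a b f ` A = f ` A"
    using assms by (auto simp: swap_at_def bijections_def bij_betw_def inj_on_def image_iff)
  then show ?thesis using assms
    by (auto simp: bijections_def bij_betw_def swap_at_def PiE_iff extensional_def)
qed

lemma card_Sigma_ge:
  assumes "finite A" "\<And>a. a \<in> A \<Longrightarrow> finite (B a) \<and> u \<le> card (B a)"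
  shows "card A * u \<le> card (Sigma A B)"
  using assms sum_bounded_below[of A u "\<lambda>a. card (B a)"] by (subst card_SigmaI) auto

subsection \<open>Partial sums of the exponential series\<close>

lemma exp_partial_sum_upper:
  fixes y :: real
  assumes "0 \<le> y"
  shows "(\<Sum>l\<le>L. y ^ l / fact l) \<le> exp y"
proof -
  have "(\<lambda>l. y ^ l / fact l) sums exp y"
    using exp_converges[of y] by (simp add: divide_inverse mult.commute)
  then show ?thesis
    using sum_le_suminf[of "\<lambda>l. y ^ l / fact l" "{..L}"] assms by (simp add: sums_iff)
qed

text \<open>Markov's inequality for the Poisson distribution of mean \<open>y\<close>.\<close>

lemma exp_partial_sum_lower:
  fixes y :: real
  assumes "0 \<le> y"
  shows "exp y * (1 - y / Suc L) \<le> (\<Sum>l\<le>L. y ^ l / fact l)"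
proof -
  let ?t = "\<lambda>l. y ^ l / fact l"
  have t: "?t sums exp y"
    using exp_converges[of y] by (simp add: divide_inverse mult.commute)
  have "(\<lambda>l. y * ?t l) sums (y * exp y)" using t by (rule sums_mult)
  also have "(\<lambda>l. y * ?t l) = (\<lambda>l. real (Suc l) * ?t (Suc l))"
    by (rule ext) (simp add: field_simps del: of_nat_Suc)
  finally have "(\<lambda>l. real (Suc l) * ?t (Suc l)) sums (y * exp y)" .
  then have 1: "(\<lambda>l. real l * ?t l) sums (y * exp y)"
    using sums_Suc_iff[of "\<lambda>l. real l * ?t l" "y * exp y"] by simp
  have "(\<lambda>l. if l \<in> {..L} then ?t l else 0) sums (\<Sum>l\<le>L. ?t l)"
    by (rule sums_If_finite_set) simp
  then have 2: "(\<lambda>l. real (Suc L) * (?t l - (if l \<in> {..L} then ?t l else 0))) sums (real (Suc L) * (exp y - (\<Sum>l\<le>L. ?t l)))"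
    by (intro sums_mult sums_diff t)
  have "real (Suc L) * (exp y - (\<Sum>l\<le>L. ?t l)) \<le> y * exp y"
  proof (rule sums_le[OF _ 2 1])
    fix l
    show "real (Suc L) * (?t l - (if l \<in> {..L} then ?t l else 0)) \<le> real l * ?t l"
    proof (cases "l \<le> L")
      case False
      then have "real (Suc L) \<le> real l" by simp
      then show ?thesis using False assms by (simp add: divide_right_mono mult_right_mono)
    qed (use assms in simp)
  qed
  then show ?thesis by (simp add: field_simps)
qed

text \<open>Iterated, the ratio bounds place \<open>a l\<close> between the terms
  \<open>a 0 * y ^ l / fact l\<close> for \<open>y = x * \<theta>\<close> and for
  \<open>y = x / \<theta>\<close>. The upper sum may run to the full exponential series; only the
  lower one pays for the tail beyond \<open>L\<close>.\<close>

lemma ratio_sandwich: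
  fixes a :: "nat \<Rightarrow> real"
  assumes "0 \<le> a 0" "0 \<le> x" "0 < \<theta>"
    and up: "\<And>l. l < L \<Longrightarrow> real (Suc l) * \<theta> * a (Suc l) \<le> x * a l"
    and low: "\<And>l. l < L \<Longrightarrow> x * \<theta> * a l \<le> real (Suc l) * a (Suc l)"
  shows "(\<Sum>l\<le>L. a l) \<le> a 0 * exp (x / \<theta>)"
    and "a 0 * (exp (x * \<theta>) * (1 - x * \<theta> / Suc L)) \<le> (\<Sum>l\<le>L. a l)"
proof -
  have 1: "a l \<le> a 0 * ((x / \<theta>) ^ l / fact l)" if "l \<le> L" for l
    using that
  proof (induction l)
    case (Suc l)
    have "real (Suc l) * \<theta> * a (Suc l) \<le> x * (a 0 * ((x / \<theta>) ^ l / fact l))"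
      using up[of l] Suc assms(2) by (intro order.trans[OF up mult_left_mono]) auto
    then have "a (Suc l) \<le> x * (a 0 * ((x / \<theta>) ^ l / fact l)) / (real (Suc l) * \<theta>)"
      using assms(3) by (subst pos_le_divide_eq) (auto simp: mult_ac)
    also have "\<dots> = a 0 * ((x / \<theta>) ^ Suc l / fact (Suc l))"
      by (simp add: field_simps del: of_nat_Suc)
    finally show ?case .
  qed simp
  have "(\<Sum>l\<le>L. a l) \<le> (\<Sum>l\<le>L. a 0 * ((x / \<theta>) ^ l / fact l))"
    using 1 by (intro sum_mono) auto
  also have "\<dots> = a 0 * (\<Sum>l\<le>L. (x / \<theta>) ^ l / fact l)" by (rule sum_distrib_left[symmetric])
  also have "\<dots> \<le> a 0 * exp (x / \<theta>)"
    using assms by (intro mult_left_mono exp_partial_sum_upper) auto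
  finally show "(\<Sum>l\<le>L. a l) \<le> a 0 * exp (x / \<theta>)" .
  have 2: "a 0 * ((x * \<theta>) ^ l / fact l) \<le> a l" if "l \<le> L" for l
    using that
  proof (induction l)
    case (Suc l)
    have "x * \<theta> * (a 0 * ((x * \<theta>) ^ l / fact l)) \<le> real (Suc l) * a (Suc l)"
      using Suc assms(2,3) by (intro order.trans[OF mult_left_mono low]) auto
    then have "x * \<theta> * (a 0 * ((x * \<theta>) ^ l / fact l)) / real (Suc l) \<le> a (Suc l)"
      by (subst pos_divide_le_eq) (auto simp: mult_ac)
    moreover have "x * \<theta> * (a 0 * ((x * \<theta>) ^ l / fact l)) / real (Suc l) = a 0 * ((x * \<theta>) ^ Suc l / fact (Suc l))"
      by (simp add: field_simps del: of_nat_Suc)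
    ultimately show ?case by simp
  qed simp
  have "a 0 * (exp (x * \<theta>) * (1 - x * \<theta> / Suc L)) \<le> a 0 * (\<Sum>l\<le>L. (x * \<theta>) ^ l / fact l)"
    using assms by (intro mult_left_mono exp_partial_sum_lower) auto
  also have "\<dots> = (\<Sum>l\<le>L. a 0 * ((x * \<theta>) ^ l / fact l))" by (rule sum_distrib_left)
  also have "\<dots> \<le> (\<Sum>l\<le>L. a l)" using 2 by (intro sum_mono) auto
  finally show "a 0 * (exp (x * \<theta>) * (1 - x * \<theta> / Suc L)) \<le> (\<Sum>l\<le>L. a l)" .
qed

section \<open>Passing to logarithms\<close>

lemma ln_one_minus_ge:
  fixes t :: real
  assumes "0 \<le> t" "t \<le> 1 / 2"
  shows "- 2 * t \<le> ln (1 - t)"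
proof -
  have "2 * t\<^sup>2 \<le> t" using assms mult_left_mono[of "2 * t" 1 t] by (simp add: power2_eq_square)
  then show ?thesis using ln_one_minus_pos_lower_bound[OF assms] by simp
qed

text \<open>\<open>r\<close> stands for the probability of simplicity and \<open>\<eta>\<close> for
  the discarded proportion; \<open>low\<close> and \<open>up\<close> are the two halves of
  \<open>ratio_sandwich\<close> after division by the total. The product \<open>x * \<beta>\<close>
  is not assumed small, and for k \<ge> 4 it may be unbounded, which is why the estimate concerns
  the logarithm.\<close>

lemma ln_ratio_bound:
  fixes r x \<beta> \<eta> \<Lambda> :: real
  assumes x: "0 \<le> x" and \<beta>: "0 \<le> \<beta>" "\<beta> \<le> 1 / 4" and \<eta>: "0 \<le> \<eta>" "\<eta> \<le> 1 / 2"
    and \<Lambda>: "0 < \<Lambda>" "x / \<Lambda> \<le> 1 / 2"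
    and low: "1 - \<eta> \<le> r * exp (x / (1 - \<beta>)\<^sup>2)"
    and up: "r * (exp (x * (1 - \<beta>)\<^sup>2) * (1 - x * (1 - \<beta>)\<^sup>2 / \<Lambda>)) \<le> 1"
  shows "0 < r" and "\<bar>ln r + x\<bar> \<le> 2 * \<eta> + 4 * (x * \<beta>) + 2 * (x / \<Lambda>)"
proof -
  have "0 < r * exp (x / (1 - \<beta>)\<^sup>2)" using low \<eta> by linarith
  then show r: "0 < r" by (simp add: zero_less_mult_iff)
  have \<theta>: "1 - 2 * \<beta> \<le> (1 - \<beta>)\<^sup>2" "(1 - \<beta>)\<^sup>2 \<le> 1"
    using \<beta> power_le_one[of "1 - \<beta>" 2] by (simp_all add: power2_diff)
  have "ln (1 - \<eta>) \<le> ln (r * exp (x / (1 - \<beta>)\<^sup>2))"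
    using low \<eta> by (subst ln_le_cancel_iff) auto
  then have 1: "- 2 * \<eta> \<le> ln r + x / (1 - \<beta>)\<^sup>2"
    using r ln_one_minus_ge[OF \<eta>] by (simp add: ln_mult)
  have "x / (1 - \<beta>)\<^sup>2 \<le> x / (1 - 2 * \<beta>)"
    using x \<beta> \<theta> by (intro divide_left_mono) auto
  \<comment> \<open>1 / (1 - 2 \<beta>) stays below 1 + 4 \<beta> exactly up to \<beta> = 1 / 4,
    hence the bound assumed on \<open>\<beta>\<close>.\<close>
  also have "\<dots> \<le> x * (1 + 4 * \<beta>)"
  proof -
    have "0 \<le> \<beta> * (1 - 4 * \<beta>)" using \<beta> by simp
    then have "1 \<le> (1 + 4 * \<beta>) * (1 - 2 * \<beta>)" by (simp add: algebra_simps)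
    then have "x * 1 \<le> x * ((1 + 4 * \<beta>) * (1 - 2 * \<beta>))" using x by (rule mult_left_mono)
    then show ?thesis using \<beta> by (subst pos_divide_le_eq) (auto simp: mult.assoc)
  qed
  finally have 2: "- (2 * \<eta> + 4 * (x * \<beta>)) \<le> ln r + x" using 1 by (simp add: algebra_simps)
  define z where "z = x * (1 - \<beta>)\<^sup>2"
  have z: "0 \<le> z" "z \<le> x" "x - 2 * (x * \<beta>) \<le> z"
    using x \<theta> mult_left_mono[OF \<theta>(1) x] mult_left_mono[OF \<theta>(2) x] by (auto simp: z_def algebra_simps)
  then have z\<Lambda>: "0 \<le> z / \<Lambda>" "z / \<Lambda> \<le> x / \<Lambda>" using \<Lambda> by (auto intro: divide_right_mono)
  then have half: "z / \<Lambda> \<le> 1 / 2" using \<Lambda> by linarith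
  then have "0 < 1 - z / \<Lambda>" by linarith
  then have "0 < r * (exp z * (1 - z / \<Lambda>))" using r by (intro mult_pos_pos) auto
  then have "ln (r * (exp z * (1 - z / \<Lambda>))) \<le> 0"
    using up[folded z_def] by (rule ln_le_zero_iff[THEN iffD2])
  then have "ln r + z + ln (1 - z / \<Lambda>) \<le> 0"
    using r \<open>0 < 1 - z / \<Lambda>\<close> by (simp only: ln_mult_pos mult_pos_pos exp_gt_zero ln_exp add.assoc)
  then have 3: "ln r + x \<le> 2 * (x * \<beta>) + 2 * (x / \<Lambda>)"
    using ln_one_minus_ge[OF z\<Lambda>(1) half] z z\<Lambda> by linarith
  have "0 \<le> x * \<beta>" "0 \<le> x / \<Lambda>" using x \<beta> \<Lambda> by auto
  then show "\<bar>ln r + x\<bar> \<le> 2 * \<eta> + 4 * (x * \<beta>) + 2 * (x / \<Lambda>)"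
    using 2 3 \<eta> by (intro abs_leI) linarith+
qed

subsection \<open>The configuration model\<close>

lemma finite_regular_hypergraphs: "finite (regular_hypergraphs k n d)"
  by (rule finite_subset[of _ "Pow (Pow {1..n})"])
    (auto simp: regular_hypergraphs_def uniform_hypergraph_def)

lemma card_edges_regular_hypergraph:
  assumes "E \<in> regular_hypergraphs k n d"
  shows "k * card E = n * d"
proof -
  have E: "E \<subseteq> Pow {1..n}" "\<And>e. e \<in> E \<Longrightarrow> card e = k" "\<And>v. v \<in> {1..n} \<Longrightarrow> card {e \<in> E. v \<in> e} = d"
    using assms by (auto simp: regular_hypergraphs_def uniform_hypergraph_def regular_hypergraph_def)
  have finE: "finite E" using E(1) by (rule finite_subset) simp
  have "(\<Sum>e\<in>E. card {v \<in> {1..n}. v \<in> e}) = d * card {1..n}"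
    using finE E(3) by (intro sum_multicount) auto
  moreover have "card {v \<in> {1..n}. v \<in> e} = k" if "e \<in> E" for e
    using that E(1,2) by (metis Collect_mem_eq Int_absorb1 Int_def PowD subsetD)
  ultimately show ?thesis by (simp add: mult.commute)
qed

text \<open>The second position of a pair is new relative to the pairs behind it, whereas the first
  may recur there. As edges of a graph the pairs form a forest, so no coincidence follows from the
  others, and the head can be undone by moving \<open>s\<close> alone.\<close>

fun fresh_pairs :: "('a \<times> 'a) list \<Rightarrow> bool" where
  "fresh_pairs [] \<longleftrightarrow> True"
| "fresh_pairs ((r, s) # xs) \<longleftrightarrow> s \<noteq> r \<and> s \<notin> fst ` set xs \<union> snd ` set xs \<and> fresh_pairs xs"

text \<open>Block \<open>b\<close> supplies the new positions. Positions in \<open>c\<close> may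
  repeat, so \<open>\<pi>\<close> need not be injective.\<close>

lemma fresh_pairs_blocks:
  "distinct js \<Longrightarrow> b \<noteq> c \<Longrightarrow> fresh_pairs (map (\<lambda>i. ((c, \<pi> i), (b, i))) js)"
  by (induction js) auto

locale configuration =
  fixes n d k M :: nat
  assumes k3: "3 \<le> k" and d1: "1 \<le> d" and kM: "k * M = n * d"
begin

text \<open>A position is a pair of a block and a slot, a point is a pair of a vertex and a copy. Properties
  that only depend on vertices are stated for words, i.e. for \<open>fst \<circ> \<sigma>\<close> with a configuration \<open>\<sigma>\<close>.\<close>

definition positions :: "(nat \<times> nat) set" where
  "positions = {..<M} \<times> {..<k}"

definition points :: "(nat \<times> nat) set" where
  "points = {1..n} \<times> {..<d}"

definition configs :: "(nat \<times> nat \<Rightarrow> nat \<times> nat) set" where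
  "configs = bijections positions points"

lemma finite_positions [simp]: "finite positions"
  and finite_points [simp]: "finite points"
  by (auto simp: positions_def points_def)

lemma card_positions [simp]: "card positions = n * d"
  and card_points [simp]: "card points = n * d"
  using kM by (auto simp: positions_def points_def mult.commute)

lemma finite_configs [simp]: "finite configs"
  by (simp add: configs_def finite_bijections)

lemma card_configs: "card configs = fact (n * d)"
  by (simp add: configs_def card_bijections)

lemma swap_at_configs:
  "\<sigma> \<in> configs \<Longrightarrow> a \<in> positions \<Longrightarrow> b \<in> positions \<Longrightarrow> swap_at a b \<sigma> \<in> configs"
  by (simp add: configs_def swap_at_bijections)

definition vertex_set :: "(nat \<times> nat \<Rightarrow> nat) \<Rightarrow> nat \<Rightarrow> nat set" where
  "vertex_set w b = w ` ({b} \<times> {..<k})"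

text \<open>Pairs are ordered: every loop is counted twice.\<close>

definition loops :: "(nat \<times> nat \<Rightarrow> nat) \<Rightarrow> ((nat \<times> nat) \<times> (nat \<times> nat)) set" where
  "loops w = {(p, q). p \<in> positions \<and> q \<in> positions \<and> p \<noteq> q \<and> fst p = fst q \<and> w p = w q}"

definition proper :: "(nat \<times> nat \<Rightarrow> nat) \<Rightarrow> nat \<Rightarrow> bool" where
  "proper w b \<longleftrightarrow> inj_on w ({b} \<times> {..<k})"

definition single_loops :: "(nat \<times> nat \<Rightarrow> nat) \<Rightarrow> bool" where
  "single_loops w \<longleftrightarrow> (\<forall>x\<in>loops w. \<forall>y\<in>loops w. fst (fst x) = fst (fst y) \<longrightarrow> y = x \<or> y = prod.swap x)"

definition regular_word :: "(nat \<times> nat \<Rightarrow> nat) \<Rightarrow> bool" where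
  "regular_word w \<longleftrightarrow> w ` positions \<subseteq> {1..n} \<and> (\<forall>v\<in>{1..n}. card {p \<in> positions. w p = v} = d)"

text \<open>Blocks are compared by their supports, not as multisets. With loops present this demands
  more than distinct multisets; for \<open>l = 0\<close> it is distinctness of edges, and it is the
  form that switchings preserve.\<close>

definition good :: "nat \<Rightarrow> (nat \<times> nat \<Rightarrow> nat) \<Rightarrow> bool" where
  "good l w \<longleftrightarrow> card (loops w) = 2 * l \<and> single_loops w \<and> inj_on (vertex_set w) {..<M}"

definition good_configs :: "nat \<Rightarrow> (nat \<times> nat \<Rightarrow> nat \<times> nat) set" where
  "good_configs l = {\<sigma> \<in> configs. good l (fst \<circ> \<sigma>)}"

lemma finite_good_configs [simp]: "finite (good_configs l)"
  by (simp add: good_configs_def)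

lemma finite_loops [simp]: "finite (loops w)"
  by (rule finite_subset[of _ "positions \<times> positions"]) (auto simp: loops_def)

lemma regular_word_config:
  assumes "\<sigma> \<in> configs"
  shows "regular_word (fst \<circ> \<sigma>)"
proof -
  have b: "bij_betw \<sigma> positions points"
    using assms by (auto simp: configs_def bijections_def)
  have inj: "inj_on \<sigma> positions" and im: "\<sigma> ` positions = points"
    using b by (auto simp: bij_betw_def)
  have "card {p \<in> positions. fst (\<sigma> p) = v} = d" if v: "v \<in> {1..n}" for v
  proof -
    have "\<sigma> ` {p \<in> positions. fst (\<sigma> p) = v} = {x \<in> \<sigma> ` positions. fst x = v}"
      by auto
    also have "\<dots> = {v} \<times> {..<d}"
      using v by (auto simp: im points_def)
    finally have "card (\<sigma> ` {p \<in> positions. fst (\<sigma> p) = v}) = d"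
      by simp
    moreover have "inj_on \<sigma> {p \<in> positions. fst (\<sigma> p) = v}"
      using inj by (rule inj_on_subset) auto
    ultimately show ?thesis by (simp add: card_image)
  qed
  moreover have "(fst \<circ> \<sigma>) ` positions \<subseteq> {1..n}"
    unfolding image_comp[symmetric] im by (auto simp: points_def)
  ultimately show ?thesis by (simp add: regular_word_def)
qed

lemma proper_iff: 
  assumes "b < M"
  shows "proper w b \<longleftrightarrow> (\<forall>x\<in>loops w. fst (fst x) \<noteq> b)"
proof
  show "proper w b \<Longrightarrow> \<forall>x\<in>loops w. fst (fst x) \<noteq> b"
    by (auto simp: proper_def loops_def positions_def dest: inj_onD)
  assume l: "\<forall>x\<in>loops w. fst (fst x) \<noteq> b"
  show "proper w b"
    unfolding proper_def
  proof (rule inj_onI, rule ccontr)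
    fix p q assume "p \<in> {b} \<times> {..<k}" "q \<in> {b} \<times> {..<k}" "w p = w q" "p \<noteq> q"
    then have "(p, q) \<in> loops w" "fst p = b" using assms by (auto simp: loops_def positions_def)
    then show False using l by force
  qed
qed

section \<open>Blocks far apart\<close>

lemma mem_positions_iff: "p \<in> positions \<longleftrightarrow> fst p < M \<and> p \<in> {fst p} \<times> {..<k}"
  by (cases p) (auto simp: positions_def)

text \<open>The block \<open>g\<close> may be \<open>b\<close> or \<open>c\<close> itself, so far
  blocks are in particular disjoint and different.\<close>

definition far :: "(nat \<times> nat \<Rightarrow> nat) \<Rightarrow> nat \<Rightarrow> nat \<Rightarrow> bool" where
  "far w b c \<longleftrightarrow> \<not> (\<exists>g<M. vertex_set w g \<inter> vertex_set w b \<noteq> {} \<and> vertex_set w g \<inter> vertex_set w c \<noteq> {})"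

lemma far_sym: "far w b c \<Longrightarrow> far w c b"
  by (auto simp: far_def)

lemma vertex_setI: "p \<in> {b} \<times> {..<k} \<Longrightarrow> w p \<in> vertex_set w b"
  unfolding vertex_set_def by (rule imageI)

lemma farD:
  assumes "far w b c" "g < M" "w p \<in> vertex_set w g" "w q \<in> vertex_set w g"
    "p \<in> {b} \<times> {..<k}" "q \<in> {c} \<times> {..<k}"
  shows False
  using assms(1-4) vertex_setI[OF assms(5)] vertex_setI[OF assms(6)] unfolding far_def by blast

lemma far_neq:
  assumes "far w b c" "b < M" "c < M" "p \<in> {b} \<times> {..<k}" "q \<in> {c} \<times> {..<k}"
  shows "w p \<noteq> w q" "b \<noteq> c"
proof -
  note p = vertex_setI[OF assms(4), of w] and q = vertex_setI[OF assms(5), of w]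
  show "w p \<noteq> w q" using farD[OF assms(1,2) p _ assms(4,5)] p by auto
  show "b \<noteq> c" using farD[OF assms(1,2) p p assms(4)] assms by auto
qed

text \<open>A block has at most \<open>k\<close> vertices, each on \<open>d\<close> positions, so at
  most \<open>k * d\<close> blocks meet it. Failing to be far means being reachable in two such
  steps.\<close>

lemma card_not_far:
  assumes w: "regular_word w" and b: "b < M"
  shows "card {c. c < M \<and> \<not> far w b c} \<le> (k * d)\<^sup>2"
proof -
  define meet where "meet c = {g. g < M \<and> vertex_set w g \<inter> vertex_set w c \<noteq> {}}" for c
  have fin: "finite (meet c)" for c by (simp add: meet_def)
  have meet: "card (meet c) \<le> k * d" if c: "c < M" for c
  proof -
    have "meet c \<subseteq> (\<Union>v\<in>vertex_set w c. fst ` {p \<in> positions. w p = v})"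
    proof
      fix g assume "g \<in> meet c"
      then obtain v p where "v \<in> vertex_set w c" "p \<in> {g} \<times> {..<k}" "w p = v" "g < M"
        by (auto simp: meet_def vertex_set_def)
      then show "g \<in> (\<Union>v\<in>vertex_set w c. fst ` {p \<in> positions. w p = v})"
        by (auto simp: positions_def intro!: image_eqI[of _ fst p])
    qed
    then have "card (meet c) \<le> card (\<Union>v\<in>vertex_set w c. fst ` {p \<in> positions. w p = v})"
      by (intro card_mono) (auto simp: vertex_set_def)
    also have "\<dots> \<le> (\<Sum>v\<in>vertex_set w c. card (fst ` {p \<in> positions. w p = v}))"
      by (rule card_UN_le) (auto simp: vertex_set_def)
    also have "\<dots> \<le> (\<Sum>v\<in>vertex_set w c. d)"
    proof (rule sum_mono)
      fix v assume "v \<in> vertex_set w c"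
      then have "v \<in> {1..n}" using w c by (force simp: vertex_set_def regular_word_def positions_def)
      then have "card {p \<in> positions. w p = v} = d" using w by (auto simp: regular_word_def)
      then show "card (fst ` {p \<in> positions. w p = v}) \<le> d"
        using card_image_le[of "{p \<in> positions. w p = v}" fst] by simp
    qed
    also have "\<dots> \<le> k * d"
      using card_image_le[of "{c} \<times> {..<k}" w] by (simp add: vertex_set_def)
    finally show ?thesis .
  qed
  have "{c. c < M \<and> \<not> far w b c} \<subseteq> (\<Union>g\<in>meet b. meet g)"
    by (auto simp: far_def meet_def)
  then have "card {c. c < M \<and> \<not> far w b c} \<le> card (\<Union>g\<in>meet b. meet g)"
    by (intro card_mono) (auto simp: fin)
  also have "\<dots> \<le> (\<Sum>g\<in>meet b. card (meet g))"
    by (rule card_UN_le) (simp add: fin)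
  also have "\<dots> \<le> (\<Sum>g\<in>meet b. k * d)"
    by (intro sum_mono meet) (auto simp: meet_def)
  also have "\<dots> \<le> (k * d) * (k * d)"
    using meet[OF b] by simp
  finally show ?thesis by (simp add: power2_eq_square)
qed

lemma card_not_proper:
  "card {b. b < M \<and> \<not> proper w b} \<le> card (loops w)"
proof -
  have "{b. b < M \<and> \<not> proper w b} \<subseteq> (\<lambda>x. fst (fst x)) ` loops w"
    using proper_iff by auto
  then show ?thesis
    by (meson card_image_le card_mono finite_imageI finite_loops le_trans)
qed

subsection \<open>Switchings\<close>

text \<open>The same map serves both directions. If \<open>p\<close> and \<open>q\<close> form a
  loop, it opens the loop and leaves equal vertices at \<open>r\<close> and \<open>s\<close>; if
  \<open>r\<close> and \<open>s\<close> carry the same vertex, it closes a loop at \<open>p\<close>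
  and \<open>q\<close>.\<close>

definition switch ::
  "nat \<times> nat \<Rightarrow> nat \<times> nat \<Rightarrow> nat \<times> nat \<Rightarrow> nat \<times> nat \<Rightarrow> (nat \<times> nat \<Rightarrow> 'b) \<Rightarrow> nat \<times> nat \<Rightarrow> 'b"
  where "switch p q r s f = swap_at p r (swap_at q s f)"

lemma switch_involutive:
  assumes "p \<noteq> q" "fst p = fst q" "fst r \<noteq> fst p" "fst s \<noteq> fst p" "fst r \<noteq> fst s"
  shows "switch p q r s (switch p q r s f) = f"
  using assms by (auto simp: switch_def swap_at_def fun_eq_iff)

lemma comp_switch: "g \<circ> switch p q r s f = switch p q r s (g \<circ> f)"
  by (auto simp: switch_def swap_at_def fun_eq_iff)

lemma switch_configs:
  assumes "\<sigma> \<in> configs" "p \<in> positions" "q \<in> positions" "r \<in> positions" "s \<in> positions"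
  shows "switch p q r s \<sigma> \<in> configs"
  using assms by (simp add: switch_def swap_at_configs)

lemma switch_apply:
  assumes "p \<noteq> q" "fst p = fst q" "fst r \<noteq> fst p" "fst s \<noteq> fst p" "fst r \<noteq> fst s"
  shows "switch p q r s f p = f r" "switch p q r s f q = f s"
    "switch p q r s f r = f p" "switch p q r s f s = f q"
    "x \<notin> {p, q, r, s} \<Longrightarrow> switch p q r s f x = f x"
  using assms by (auto simp: switch_def swap_at_def)

lemma switch_apply_other_block:
  "fst x \<notin> {fst p, fst q, fst r, fst s} \<Longrightarrow> switch p q r s f x = f x"
  by (auto simp: switch_def swap_at_def)

lemma vertex_set_switch_other:
  "g \<notin> {fst p, fst q, fst r, fst s} \<Longrightarrow> vertex_set (switch p q r s w) g = vertex_set w g"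
  unfolding vertex_set_def by (rule image_cong) (auto simp: switch_apply_other_block)

lemma vertex_set_switch_upper:
  assumes "p \<noteq> q" "fst p = fst q" "fst r \<noteq> fst p" "fst s \<noteq> fst p" "fst r \<noteq> fst s"
  shows "vertex_set (switch p q r s w) (fst p) \<subseteq> insert (w r) (insert (w s) (w ` ({fst p} \<times> {..<k} - {p, q})))"
    "vertex_set (switch p q r s w) (fst r) \<subseteq> insert (w p) (w ` ({fst r} \<times> {..<k} - {r}))"
    "vertex_set (switch p q r s w) (fst s) \<subseteq> insert (w q) (w ` ({fst s} \<times> {..<k} - {s}))"
  using assms unfolding vertex_set_def switch_def swap_at_def
  by (auto simp: image_iff split: if_splits)

text \<open>This is where k \<ge> 3 enters the switching: a block that exchanges two of its points
  keeps a third, whose vertex still ties it to its old place.\<close>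

lemma third_index:
  assumes "p \<in> {b} \<times> {..<k}" "q \<in> {b} \<times> {..<k}"
  obtains x where "x \<in> {b} \<times> {..<k} - {p, q}"
proof -
  have "card {p, q} < card ({b} \<times> {..<k})"
    using k3 card_insert_le_m1[of 2 "{q}" p] by simp
  then have "\<not> {b} \<times> {..<k} \<subseteq> {p, q}"
    by (meson card_mono finite.emptyI finite_insert not_le)
  then show ?thesis using that by blast
qed

text \<open>If a new block agreed with an old one, that old block would meet two blocks that are far
  apart before the switching.\<close>

lemma inj_vertex_set_switch:
  assumes inj: "inj_on (vertex_set w) {..<M}"
    and pos: "p \<in> positions" "q \<in> positions" "r \<in> positions" "s \<in> positions"
    and pq: "p \<noteq> q" "fst p = fst q"
    and far: "far w (fst p) (fst r)" "far w (fst p) (fst s)" and rs: "fst r \<noteq> fst s"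
    and proper: "proper w (fst r)" "proper w (fst s)"
    and sep: "w p \<noteq> w q \<or> far w (fst r) (fst s)"
  shows "inj_on (vertex_set (switch p q r s w)) {..<M}"
proof -
  let ?w = "switch p q r s w"
  let ?V = "vertex_set ?w"
  define e f g where "e = fst p" and "f = fst r" and "g = fst s"
  have lt: "e < M" "f < M" "g < M"
    and blk: "p \<in> {e} \<times> {..<k}" "q \<in> {e} \<times> {..<k}" "r \<in> {f} \<times> {..<k}" "s \<in> {g} \<times> {..<k}"
    using pos pq by (auto simp: mem_positions_iff e_def f_def g_def)
  have far_ef: "far w e f" and far_eg: "far w e g" and fg: "f \<noteq> g"
    using far rs by (auto simp: e_def f_def g_def)
  have ef: "e \<noteq> f" and eg: "e \<noteq> g"
    using far_neq(2)[OF far_ef lt(1,2) blk(1,3)] far_neq(2)[OF far_eg lt(1,3) blk(1,4)] by auto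
  have dist: "fst r \<noteq> fst p" "fst s \<noteq> fst p"
    using ef eg by (auto simp: e_def f_def g_def)
  note app = switch_apply[OF pq dist rs, where f = w]
  obtain x where x: "x \<in> {e} \<times> {..<k} - {p, q}" using third_index[OF blk(1,2)] .
  obtain y where y: "y \<in> {f} \<times> {..<k} - {r, r}" using third_index[OF blk(3,3)] .
  obtain z where z: "z \<in> {g} \<times> {..<k} - {s, s}" using third_index[OF blk(4,4)] .
  have wx: "?w x = w x" "?w y = w y" "?w z = w z"
    using x y z ef eg fg blk by (auto intro!: app(5))
  have inE: "w r \<in> ?V e" "w s \<in> ?V e" "w x \<in> ?V e"
    using vertex_setI[of _ e ?w] blk x app wx by auto (metis+)?
  have inF: "w p \<in> ?V f" "w y \<in> ?V f" and inG: "w q \<in> ?V g" "w z \<in> ?V g"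
    using vertex_setI[of r f ?w] vertex_setI[of y f ?w] vertex_setI[of s g ?w] vertex_setI[of z g ?w]
      blk y z app wx by auto
  note upper = vertex_set_switch_upper[OF pq dist rs, of w, folded e_def f_def g_def]
  have new_old: "?V a \<noteq> ?V c" if a: "a \<in> {e, f, g}" and c: "c < M" "c \<notin> {e, f, g}" for a c
  proof
    assume eq: "?V a = ?V c"
    have Vc: "?V c = vertex_set w c"
      using c(2) pq by (intro vertex_set_switch_other) (auto simp: e_def f_def g_def)
    consider "a = e" | "a = f" | "a = g" using a by blast
    then show False
    proof cases
      case 1
      then show False using farD[OF far_ef c(1), of x r] inE eq Vc x blk by auto
    next
      case 2
      then show False using farD[OF far_ef c(1), of p y] inF eq Vc y blk by auto
    next
      case 3
      then show False using farD[OF far_eg c(1), of q z] inG eq Vc z blk by auto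
    qed
  qed
  \<comment> \<open>\<open>w r\<close> has moved from \<open>f\<close> to \<open>e\<close>. As
    \<open>f\<close> is proper it held no second copy of this vertex, and the incoming
    \<open>w p\<close> differs from it. The same argument separates \<open>e\<close> from
    \<open>g\<close>.\<close>
  have "?V e \<noteq> ?V f"
  proof
    assume "?V e = ?V f"
    then have "w r \<in> insert (w p) (w ` ({f} \<times> {..<k} - {r}))" using inE upper(2) by auto
    moreover have "w p \<noteq> w r" using far_neq(1)[OF far_ef lt(1,2) blk(1,3)] .
    ultimately show False
      using proper(1) blk(3) unfolding proper_def f_def[symmetric] by (auto dest: inj_onD)
  qed
  moreover have "?V e \<noteq> ?V g"
  proof
    assume "?V e = ?V g"
    then have "w s \<in> insert (w q) (w ` ({g} \<times> {..<k} - {s}))" using inE upper(3) by auto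
    moreover have "w q \<noteq> w s" using far_neq(1)[OF far_eg lt(1,3) blk(2,4)] .
    ultimately show False
      using proper(2) blk(4) unfolding proper_def g_def[symmetric] by (auto dest: inj_onD)
  qed
  moreover have "?V f \<noteq> ?V g"
  proof
    assume eq: "?V f = ?V g"
    \<comment> \<open>The two alternatives are the two directions. When a loop is created,
      \<open>f\<close> and \<open>g\<close> share a vertex and cannot be far, but \<open>w p\<close>
      and \<open>w q\<close> differ; when one is removed, \<open>w p = w q\<close> and the distance
      of \<open>f\<close> and \<open>g\<close> is used.\<close>
    from sep show False
    proof
      assume "w p \<noteq> w q"
      then have "w p \<in> w ` ({g} \<times> {..<k})" using eq inF upper(3) by auto
      then obtain t where "t \<in> {g} \<times> {..<k}" "w p = w t" by (rule imageE)
      then show False using far_neq(1)[OF far_eg lt(1,3) blk(1)] by auto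
    next
      assume "far w (fst r) (fst s)"
      then have ffg: "far w f g" by (simp add: f_def g_def)
      have "w y \<noteq> w q" using far_neq(1)[OF far_ef lt(1,2) blk(2), of y] y by auto
      then have "w y \<in> w ` ({g} \<times> {..<k})" using eq inF upper(3) by auto
      then obtain t where "t \<in> {g} \<times> {..<k}" "w y = w t" by (rule imageE)
      then show False using far_neq(1)[OF ffg lt(2,3), of y t] y by auto
    qed
  qed
  moreover have "?V b = vertex_set w b" if "b \<notin> {e, f, g}" for b
    using that pq by (intro vertex_set_switch_other) (auto simp: e_def f_def g_def)
  ultimately show ?thesis
    using new_old inj unfolding inj_on_def by (smt (verit) insert_iff lessThan_iff singletonD)
qed

lemma loops_switch_other:
  assumes "b \<notin> {fst p, fst q, fst r, fst s}" "fst (fst x) = b"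
  shows "x \<in> loops (switch p q r s w) \<longleftrightarrow> x \<in> loops w"
  using assms by (cases x) (auto simp: loops_def switch_apply_other_block)

text \<open>Only three blocks change. The block of \<open>p\<close> has no other loop and receives
  two vertices that are new to it and distinct, because the blocks of \<open>r\<close> and
  \<open>s\<close> are far from it and from each other. Those two blocks each receive a vertex new
  to them. So all three end up proper.\<close>

lemma loops_switch_remove:
  assumes single: "single_loops w" and l: "(p, q) \<in> loops w"
    and pos: "r \<in> positions" "s \<in> positions"
    and far: "far w (fst p) (fst r)" "far w (fst p) (fst s)" "far w (fst r) (fst s)"
    and proper: "proper w (fst r)" "proper w (fst s)"
  shows "loops (switch p q r s w) = loops w - {(p, q), (q, p)}"
proof -
  let ?w = "switch p q r s w"
  define e f g where "e = fst p" and "f = fst r" and "g = fst s"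
  have pq: "p \<noteq> q" "fst p = fst q" "w p = w q" "p \<in> positions" "q \<in> positions"
    using l by (auto simp: loops_def)
  have lt: "e < M" "f < M" "g < M"
    and blk: "p \<in> {e} \<times> {..<k}" "q \<in> {e} \<times> {..<k}" "r \<in> {f} \<times> {..<k}" "s \<in> {g} \<times> {..<k}"
    using pos pq by (auto simp: mem_positions_iff e_def f_def g_def)
  have fars: "far w e f" "far w e g" "far w f g"
    using far by (auto simp: e_def f_def g_def)
  have ne: "e \<noteq> f" "e \<noteq> g" "f \<noteq> g"
    using far_neq(2)[OF fars(1) lt(1,2) blk(1,3)] far_neq(2)[OF fars(2) lt(1,3) blk(1,4)]
      far_neq(2)[OF fars(3) lt(2,3) blk(3,4)] by auto
  note app = switch_apply[of p q r s, where f = w]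
  have ap: "?w p = w r" "?w q = w s" "?w r = w p" "?w s = w q"
      "\<And>x. x \<notin> {p, q, r, s} \<Longrightarrow> ?w x = w x"
    using app ne pq by (auto simp: e_def f_def g_def)
  have in_e: "w x \<noteq> w y" if "x \<in> {e} \<times> {..<k}" "y \<in> {e} \<times> {..<k}" "x \<noteq> y" "{x, y} \<noteq> {p, q}" for x y
  proof
    assume "w x = w y"
    then have "(x, y) \<in> loops w" using that lt by (auto simp: loops_def positions_def)
    then have "(x, y) = (p, q) \<or> (x, y) = (q, p)"
      using single l that(1) blk(1) unfolding single_loops_def by fastforce
    then show False using that by auto
  qed
  have 1: "proper ?w e"
    unfolding proper_def
  proof (rule inj_onI, rule ccontr)
    fix x y assume xy: "x \<in> {e} \<times> {..<k}" "y \<in> {e} \<times> {..<k}" "?w x = ?w y" "x \<noteq> y"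
    have other: "?w z \<noteq> ?w p \<and> ?w z \<noteq> ?w q" if "z \<in> {e} \<times> {..<k}" "z \<notin> {p, q}" for z
    proof -
      have "?w z = w z" using that blk ne by (intro ap(5)) auto
      then show ?thesis using ap that far_neq(1)[OF fars(1) lt(1,2) _ blk(3), of z]
        far_neq(1)[OF fars(2) lt(1,3) _ blk(4), of z] by auto
    qed
    have rs: "?w p \<noteq> ?w q" using ap far_neq(1)[OF fars(3) lt(2,3) blk(3,4)] by auto
    show False
    proof (cases "x \<in> {p, q} \<or> y \<in> {p, q}")
      case True
      then show False using other[of x] other[of y] xy rs by (metis insertE singletonD)
    next
      case False
      then have "x \<notin> {p, q, r, s}" "y \<notin> {p, q, r, s}" using xy blk ne by auto
      then have "?w x = w x" "?w y = w y" using ap(5) by auto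
      moreover have "{x, y} \<noteq> {p, q}" using False by auto
      ultimately show False using in_e[of x y] xy by auto
    qed
  qed
  have prop_block: "proper ?w c"
    if c: "c < M" "far w e c" "proper w c" "t \<in> {c} \<times> {..<k}" "?w t = w p"
      "\<And>x. x \<in> {c} \<times> {..<k} \<Longrightarrow> x \<noteq> t \<Longrightarrow> ?w x = w x" for c t
    unfolding proper_def
  proof (rule inj_onI, rule ccontr)
    fix x y assume xy: "x \<in> {c} \<times> {..<k}" "y \<in> {c} \<times> {..<k}" "?w x = ?w y" "x \<noteq> y"
    have other: "?w z \<noteq> ?w t" if "z \<in> {c} \<times> {..<k}" "z \<noteq> t" for z
      using c(5,6) that far_neq(1)[OF c(2) lt(1) c(1) blk(1), of z] by auto
    show False
      using other[of x] other[of y] xy c(3,6) by (metis inj_onD proper_def)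
  qed
  have 2: "proper ?w f"
    using fars proper blk ap ne lt by (intro prop_block[of f r]) (auto simp: f_def[symmetric] intro!: ap(5))
  have 3: "proper ?w g"
    using fars proper blk ap ne lt pq by (intro prop_block[of g s]) (auto simp: g_def[symmetric] intro!: ap(5))
  show ?thesis
  proof (rule set_eqI)
    fix x :: "(nat \<times> nat) \<times> (nat \<times> nat)"
    consider "fst (fst x) \<notin> {e, f, g}" | "fst (fst x) = e" | "fst (fst x) = f" | "fst (fst x) = g"
      by blast
    then show "x \<in> loops ?w \<longleftrightarrow> x \<in> loops w - {(p, q), (q, p)}"
    proof cases
      case 1
      then have "x \<noteq> (p, q)" "x \<noteq> (q, p)" using pq by (auto simp: e_def)
      then show ?thesis using loops_switch_other[OF _ refl, of x p q r s w] 1 pq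
        by (auto simp: e_def f_def g_def)
    next
      case 2
      have "x \<in> loops w \<Longrightarrow> x = (p, q) \<or> x = (q, p)"
        using single l 2 unfolding single_loops_def by (fastforce simp: e_def)
      then show ?thesis using 1 2 proper_iff[OF lt(1), of ?w] by auto
    next
      case 3
      then have "x \<notin> loops ?w" "x \<notin> loops w"
        using 2 proper proper_iff[OF lt(2)] by (auto simp: f_def)
      then show ?thesis by auto
    next
      case 4
      then have "x \<notin> loops ?w" "x \<notin> loops w"
        using 3 proper proper_iff[OF lt(3)] by (auto simp: g_def)
      then show ?thesis by auto
    qed
  qed
qed

text \<open>The common vertex of \<open>r\<close> and \<open>s\<close> arrives twice in the block of
  \<open>p\<close>, to which it is new, and makes exactly one loop there. The blocks of
  \<open>r\<close> and \<open>s\<close> each receive a vertex new to them and stay proper.\<close>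

lemma loops_switch_create:
  assumes pq: "p \<in> positions" "q \<in> positions" "p \<noteq> q" "fst p = fst q"
    and pos: "r \<in> positions" "s \<in> positions" and rs: "w r = w s" "fst r \<noteq> fst s"
    and far: "far w (fst p) (fst r)" "far w (fst p) (fst s)"
    and proper: "proper w (fst p)" "proper w (fst r)" "proper w (fst s)"
  shows "loops (switch p q r s w) = insert (p, q) (insert (q, p) (loops w))"
proof -
  let ?w = "switch p q r s w"
  define e f g where "e = fst p" and "f = fst r" and "g = fst s"
  have lt: "e < M" "f < M" "g < M"
    and blk: "p \<in> {e} \<times> {..<k}" "q \<in> {e} \<times> {..<k}" "r \<in> {f} \<times> {..<k}" "s \<in> {g} \<times> {..<k}"
    using pos pq by (auto simp: mem_positions_iff e_def f_def g_def)
  have fars: "far w e f" "far w e g"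
    using far by (auto simp: e_def f_def g_def)
  have ne: "e \<noteq> f" "e \<noteq> g" "f \<noteq> g"
    using far_neq(2)[OF fars(1) lt(1,2) blk(1,3)] far_neq(2)[OF fars(2) lt(1,3) blk(1,4)]
      rs by (auto simp: f_def g_def)
  have ap: "?w p = w r" "?w q = w r" "?w r = w p" "?w s = w q"
      "\<And>x. x \<notin> {p, q, r, s} \<Longrightarrow> ?w x = w x"
    using switch_apply[of p q r s, where f = w] ne pq rs by (auto simp: e_def f_def g_def)
  have prop_block: "proper ?w c"
    if c: "c < M" "far w e c" "proper w c" "t \<in> {c} \<times> {..<k}" "u \<in> {e} \<times> {..<k}" "?w t = w u"
      "\<And>x. x \<in> {c} \<times> {..<k} \<Longrightarrow> x \<noteq> t \<Longrightarrow> ?w x = w x" for c t u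
    unfolding proper_def
  proof (rule inj_onI, rule ccontr)
    fix x y assume xy: "x \<in> {c} \<times> {..<k}" "y \<in> {c} \<times> {..<k}" "?w x = ?w y" "x \<noteq> y"
    have other: "?w z \<noteq> ?w t" if "z \<in> {c} \<times> {..<k}" "z \<noteq> t" for z
      using c(6,7) that far_neq(1)[OF c(2) lt(1) c(1) c(5), of z] by auto
    show False
      using other[of x] other[of y] xy c(3,7) by (metis inj_onD proper_def)
  qed
  have 2: "proper ?w f"
    using fars proper blk ap ne lt by (intro prop_block[of f r p]) (auto simp: f_def[symmetric] intro!: ap(5))
  have 3: "proper ?w g"
    using fars proper blk ap ne lt by (intro prop_block[of g s q]) (auto simp: g_def[symmetric] intro!: ap(5))
  have in_e: "?w x = ?w y \<longleftrightarrow> (x, y) = (p, q) \<or> (x, y) = (q, p)"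
    if xy: "x \<in> {e} \<times> {..<k}" "y \<in> {e} \<times> {..<k}" "x \<noteq> y" for x y
  proof -
    have other: "?w z = w z \<and> w z \<noteq> w r" if "z \<in> {e} \<times> {..<k}" "z \<notin> {p, q}" for z
      using that blk ne far_neq(1)[OF fars(1) lt(1,2) _ blk(3), of z] by (auto intro!: ap(5))
    have "w x \<noteq> w y"
      using proper(1) xy unfolding proper_def e_def[symmetric] by (auto dest: inj_onD)
    then show ?thesis
      using other[of x] other[of y] ap(1,2) xy
      by (cases "x \<in> {p, q}"; cases "y \<in> {p, q}") auto
  qed
  show ?thesis
  proof (rule set_eqI)
    fix x :: "(nat \<times> nat) \<times> (nat \<times> nat)"
    consider "fst (fst x) \<notin> {e, f, g}" | "fst (fst x) = e" | "fst (fst x) = f" | "fst (fst x) = g"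
      by blast
    then show "x \<in> loops ?w \<longleftrightarrow> x \<in> insert (p, q) (insert (q, p) (loops w))"
    proof cases
      case 1
      then have "x \<noteq> (p, q)" "x \<noteq> (q, p)" using pq by (auto simp: e_def)
      then show ?thesis using loops_switch_other[OF _ refl, of x p q r s w] 1 pq
        by (auto simp: e_def f_def g_def)
    next
      case 2
      have no: "x \<notin> loops w" using proper(1) 2 proper_iff[OF lt(1), of w] by (auto simp: e_def)
      obtain y z where x: "x = (y, z)" by (cases x)
      have "x \<in> loops ?w \<longleftrightarrow> y \<in> {e} \<times> {..<k} \<and> z \<in> {e} \<times> {..<k} \<and> y \<noteq> z \<and> ?w y = ?w z"
        using 2 lt by (auto simp: loops_def positions_def x)
      also have "\<dots> \<longleftrightarrow> x = (p, q) \<or> x = (q, p)"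
        using in_e[of y z] blk pq by (auto simp: x)
      finally show ?thesis using no by auto
    next
      case 3
      then have "x \<notin> loops ?w" "x \<notin> loops w"
        using 2 proper proper_iff[OF lt(2)] by (auto simp: f_def)
      then show ?thesis using 3 ne pq by (auto simp: e_def)
    next
      case 4
      then have "x \<notin> loops ?w" "x \<notin> loops w"
        using 3 proper proper_iff[OF lt(3)] by (auto simp: g_def)
      then show ?thesis using 4 ne pq by (auto simp: e_def)
    qed
  qed
qed

lemma good_switch_remove:
  assumes good: "good (Suc l) w" and l: "(p, q) \<in> loops w"
    and pos: "r \<in> positions" "s \<in> positions"
    and far: "far w (fst p) (fst r)" "far w (fst p) (fst s)" "far w (fst r) (fst s)"
    and proper: "proper w (fst r)" "proper w (fst s)"
  shows "good l (switch p q r s w)"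
proof -
  have eq: "loops (switch p q r s w) = loops w - {(p, q), (q, p)}"
    using loops_switch_remove[OF _ l pos far proper] good by (simp add: good_def)
  have pq: "p \<noteq> q" "fst p = fst q" "p \<in> positions" "q \<in> positions" "(q, p) \<in> loops w"
    using l by (auto simp: loops_def)
  have "card (loops w - {(p, q), (q, p)}) = card (loops w) - card {(p, q), (q, p)}"
    using pq l by (intro card_Diff_subset) auto
  then have "card (loops (switch p q r s w)) = 2 * l"
    using eq good pq by (simp add: good_def)
  moreover have "single_loops (switch p q r s w)"
    using good by (simp add: good_def single_loops_def eq)
  moreover have rs: "fst r \<noteq> fst s"
    using pos far_neq(2)[OF far(3), of r s] by (auto simp: mem_positions_iff)
  moreover have "inj_on (vertex_set (switch p q r s w)) {..<M}"
    using good far rs by (intro inj_vertex_set_switch pq pos proper) (auto simp: good_def)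
  ultimately show ?thesis by (simp add: good_def)
qed

lemma good_switch_create:
  assumes good: "good l w"
    and pq: "p \<in> positions" "q \<in> positions" "p \<noteq> q" "fst p = fst q"
    and pos: "r \<in> positions" "s \<in> positions" and rs: "w r = w s" "fst r \<noteq> fst s"
    and far: "far w (fst p) (fst r)" "far w (fst p) (fst s)"
    and proper: "proper w (fst p)" "proper w (fst r)" "proper w (fst s)"
  shows "good (Suc l) (switch p q r s w)"
proof -
  have eq: "loops (switch p q r s w) = insert (p, q) (insert (q, p) (loops w))"
    by (rule loops_switch_create[OF pq pos rs far proper])
  have lt: "fst p < M" using pq by (simp add: mem_positions_iff)
  have no: "fst (fst x) \<noteq> fst p" if "x \<in> loops w" for x
    using that proper(1) proper_iff[OF lt] by auto
  then have nin: "(p, q) \<notin> loops w" "(q, p) \<notin> loops w" using pq(4) by fastforce+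
  have "card (loops (switch p q r s w)) = 2 * Suc l"
    using good nin pq by (simp add: good_def eq)
  moreover have "single_loops (switch p q r s w)"
    unfolding single_loops_def
  proof (intro ballI impI)
    fix x y assume xy: "x \<in> loops (switch p q r s w)" "y \<in> loops (switch p q r s w)"
      "fst (fst x) = fst (fst y)"
    show "y = x \<or> y = prod.swap x"
    proof (cases "x \<in> loops w \<and> y \<in> loops w")
      case True
      then show ?thesis using good xy(3) by (auto simp: good_def single_loops_def)
    next
      case False
      then have "fst (fst x) = fst p" using xy pq(4) by (auto simp: eq)
      then have "x \<notin> loops w" "y \<notin> loops w" using no xy(3) by metis+
      then show ?thesis using xy by (auto simp: eq)
    qed
  qed
  moreover have "w p \<noteq> w q"
    using proper(1) pq by (auto simp: proper_def mem_positions_iff dest: inj_onD)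
  then have "inj_on (vertex_set (switch p q r s w)) {..<M}"
    using good by (intro inj_vertex_set_switch pq pos proper far rs) (auto simp: good_def)
  ultimately show ?thesis by (simp add: good_def)
qed

section \<open>Counting the choices for a switching\<close>

lemma card_block_positions:
  "card {p \<in> positions. P (fst p)} = k * card {c. c < M \<and> P c}"
proof -
  have "{p \<in> positions. P (fst p)} = {c. c < M \<and> P c} \<times> {..<k}"
    by (auto simp: positions_def)
  then show ?thesis by (simp add: card_cartesian_product)
qed

lemma card_proper_positions:
  assumes "card (loops w) = 2 * l" "2 * k * l \<le> B"
  shows "n * d \<le> card {p \<in> positions. proper w (fst p)} + B"
proof -
  have "card {p \<in> positions. \<not> proper w (fst p)} \<le> k * (2 * l)"
    using card_block_positions[of "\<lambda>c. \<not> proper w c"] card_not_proper[of w] assms by simp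
  moreover have "card positions = card {p \<in> positions. proper w (fst p)} + card {p \<in> positions. \<not> proper w (fst p)}"
  proof -
    have "positions = {p \<in> positions. proper w (fst p)} \<union> {p \<in> positions. \<not> proper w (fst p)}" by auto
    then show ?thesis by (metis (no_types, lifting) card_Un_disjoint disjoint_iff finite_Un finite_positions mem_Collect_eq)
  qed
  ultimately show ?thesis using assms(2) by simp
qed

text \<open>Two blocks have to be avoided: those of the loop and of \<open>r\<close> when
  \<open>s\<close> is chosen, and those of \<open>r\<close> and \<open>s\<close> when the place of a
  new loop is chosen. A single block to avoid is the case \<open>e = f\<close>.\<close>

lemma card_far_positions:
  assumes w: "regular_word w" "card (loops w) = 2 * l" and ef: "e < M" "f < M"
    and B: "2 * k * l + 2 * k * (k * d)\<^sup>2 \<le> B"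
  shows "n * d - B \<le> card {p \<in> positions. proper w (fst p) \<and> far w e (fst p) \<and> far w f (fst p)}"
    (is "_ \<le> card ?G")
proof -
  have nf: "card {p \<in> positions. \<not> far w c (fst p)} \<le> k * (k * d)\<^sup>2" if "c < M" for c
    using card_block_positions[of "\<lambda>b. \<not> far w c b"] card_not_far[OF w(1) that] by simp
  have "{p \<in> positions. proper w (fst p)} \<subseteq>
      ?G \<union> ({p \<in> positions. \<not> far w e (fst p)} \<union> {p \<in> positions. \<not> far w f (fst p)})"
    by auto
  then have "card {p \<in> positions. proper w (fst p)} \<le>
      card (?G \<union> ({p \<in> positions. \<not> far w e (fst p)} \<union> {p \<in> positions. \<not> far w f (fst p)}))"
    by (intro card_mono) auto
  also have "\<dots> \<le> card ?G + (card {p \<in> positions. \<not> far w e (fst p)} + card {p \<in> positions. \<not> far w f (fst p)})"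
    by (meson add_le_mono card_Un_le le_refl le_trans)
  finally have "card {p \<in> positions. proper w (fst p)} \<le> card ?G + (k * (k * d)\<^sup>2 + k * (k * d)\<^sup>2)"
    using nf[OF ef(1)] nf[OF ef(2)] by linarith
  with card_proper_positions[OF w(2) order.refl] B show ?thesis by linarith
qed

lemma card_block_partners:
  assumes "p \<in> positions"
  shows "card {q \<in> positions. q \<noteq> p \<and> fst q = fst p} = k - 1"
proof -
  have "{q \<in> positions. q \<noteq> p \<and> fst q = fst p} = ({fst p} \<times> {..<k}) - {p}"
    using assms by (auto simp: positions_def)
  then show ?thesis using assms by (simp add: card_Diff_singleton mem_positions_iff)
qed

lemma card_vertex_partners:
  assumes "regular_word w" "p \<in> positions"
  shows "card {q \<in> positions. q \<noteq> p \<and> w p = w q} = d - 1"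
proof -
  have "{q \<in> positions. q \<noteq> p \<and> w p = w q} = {q \<in> positions. w q = w p} - {p}"
    by auto
  moreover have "card {q \<in> positions. w q = w p} = d"
    using assms by (auto simp: regular_word_def)
  ultimately show ?thesis using assms by (simp add: card_Diff_singleton)
qed

definition block_pairs :: "((nat \<times> nat) \<times> (nat \<times> nat)) set" where
  "block_pairs = (SIGMA p:positions. {q \<in> positions. q \<noteq> p \<and> fst q = fst p})"

definition vertex_pairs :: "(nat \<times> nat \<Rightarrow> nat) \<Rightarrow> ((nat \<times> nat) \<times> (nat \<times> nat)) set" where
  "vertex_pairs w = (SIGMA p:positions. {q \<in> positions. q \<noteq> p \<and> w p = w q})"

lemma card_block_pairs: "card block_pairs = n * d * (k - 1)"
  unfolding block_pairs_def by (subst card_SigmaI) (auto simp: card_block_partners)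

lemma card_vertex_pairs: "regular_word w \<Longrightarrow> card (vertex_pairs w) = n * d * (d - 1)"
  unfolding vertex_pairs_def by (subst card_SigmaI) (auto simp: card_vertex_partners)

lemma finite_pairs [simp]: "finite block_pairs" "finite (vertex_pairs w)"
  by (auto simp: block_pairs_def vertex_pairs_def)

text \<open>At most \<open>2 * k * l\<close> positions lie in blocks with loops, each has
  \<open>d - 1\<close> partners, and either end of a pair may be the bad one. The loss keeps the
  factor \<open>d - 1\<close>, so it is a relative error of the main term.\<close>

lemma card_proper_vertex_pairs:
  assumes w: "regular_word w" "card (loops w) = 2 * l" and B: "4 * k * l \<le> B"
  shows "(n * d - B) * (d - 1) \<le> card {(r, s) \<in> vertex_pairs w. proper w (fst r) \<and> proper w (fst s)}"
    (is "_ \<le> card ?G")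
proof -
  define X where "X = {p \<in> positions. \<not> proper w (fst p)}"
  have X: "card X \<le> 2 * k * l"
    using card_block_positions[of "\<lambda>c. \<not> proper w c"] card_not_proper[of w] w(2) by (simp add: X_def)
  define Y where "Y = (SIGMA p:X. {q \<in> positions. q \<noteq> p \<and> w p = w q})"
  have "card Y = card X * (d - 1)"
    unfolding Y_def by (subst card_SigmaI) (auto simp: card_vertex_partners[OF w(1)] X_def)
  then have Y: "card Y \<le> 2 * k * l * (d - 1)" using X by simp
  have finY: "finite Y" by (auto simp: Y_def X_def)
  have "vertex_pairs w \<subseteq> ?G \<union> (Y \<union> prod.swap ` Y)"
    by (force simp: vertex_pairs_def Y_def X_def image_iff)
  then have "card (vertex_pairs w) \<le> card (?G \<union> (Y \<union> prod.swap ` Y))"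
    by (intro card_mono finite_UnI finY finite_imageI) (auto intro: finite_subset[of _ "vertex_pairs w"])
  also have "\<dots> \<le> card ?G + (card Y + card Y)"
    by (meson add_le_mono card_Un_le card_image_le finY le_refl le_trans)
  finally have "n * d * (d - 1) \<le> card ?G + 4 * k * l * (d - 1)"
    using Y card_vertex_pairs[OF w(1)] by simp
  moreover have "4 * k * l * (d - 1) \<le> B * (d - 1)" using B by (rule mult_le_mono1)
  ultimately show ?thesis unfolding diff_mult_distrib by linarith
qed

text \<open>Forward there are 2 (l + 1) ordered loops and at least n d - B choices for each of
  \<open>r\<close> and \<open>s\<close>. Backward there are n d (k - 1) pairs of slots in one block
  and n d (d - 1) pairs of positions of one vertex. The quotient of the main terms is x / (l + 1),
  which explains x = (k - 1) (d - 1) / 2.\<close>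

lemma removal_count:
  assumes B: "4 * k * Suc l + 2 * k * (k * d)\<^sup>2 \<le> B"
  shows "(2 * Suc l * (n * d - B)\<^sup>2) * card (good_configs (Suc l))
    \<le> (n * d * (k - 1) * (n * d * (d - 1))) * card (good_configs l)"
proof -
  define avail where "avail w e f = {p \<in> positions. proper w (fst p) \<and> far w e (fst p) \<and> far w f (fst p)}"
    for w :: "nat \<times> nat \<Rightarrow> nat" and e f
  \<comment> \<open>For \<open>r\<close> only the block of the loop has to be avoided, hence the
    repeated argument; \<open>s\<close> must also avoid the block of \<open>r\<close>.\<close>
  define C where "C \<sigma> = (SIGMA x:loops (fst \<circ> \<sigma>). SIGMA r:avail (fst \<circ> \<sigma>) (fst (fst x)) (fst (fst x)).
      avail (fst \<circ> \<sigma>) (fst (fst x)) (fst r))" for \<sigma> :: "nat \<times> nat \<Rightarrow> nat \<times> nat"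
  define g where "g = (\<lambda>((p, q), (r, s)). switch p q r s :: (nat \<times> nat \<Rightarrow> nat \<times> nat) \<Rightarrow> _)"
  have fin: "finite (avail w e f)" for w e f by (simp add: avail_def)
  show ?thesis
  proof (rule double_counting_le[where C = C and g = g and D = "\<lambda>\<tau>. block_pairs \<times> vertex_pairs (fst \<circ> \<tau>)"])
    fix \<sigma> assume \<sigma>: "\<sigma> \<in> good_configs (Suc l)"
    then have w: "regular_word (fst \<circ> \<sigma>)" "card (loops (fst \<circ> \<sigma>)) = 2 * Suc l"
      by (auto simp: good_configs_def good_def regular_word_config)
    have B': "2 * k * Suc l + 2 * k * (k * d)\<^sup>2 \<le> B" using B by simp
    have av: "n * d - B \<le> card (avail (fst \<circ> \<sigma>) e f)" if "e < M" "f < M" for e f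
      unfolding avail_def using card_far_positions[OF w that B'] .
    have "card (loops (fst \<circ> \<sigma>)) * ((n * d - B) * (n * d - B)) \<le> card (C \<sigma>)"
      unfolding C_def
    proof (rule card_Sigma_ge[OF finite_loops], rule conjI)
      fix x assume "x \<in> loops (fst \<circ> \<sigma>)"
      then have a: "fst (fst x) < M" by (auto simp: loops_def positions_def)
      let ?a = "fst (fst x)"
      let ?S = "SIGMA r:avail (fst \<circ> \<sigma>) ?a ?a. avail (fst \<circ> \<sigma>) ?a (fst r)"
      show "finite ?S" using fin by auto
      have "card (avail (fst \<circ> \<sigma>) ?a ?a) * (n * d - B) \<le> card ?S"
        using a by (intro card_Sigma_ge fin conjI av) (auto simp: avail_def positions_def)
      moreover have "(n * d - B) * (n * d - B) \<le> card (avail (fst \<circ> \<sigma>) ?a ?a) * (n * d - B)"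
        using av[OF a a] by (rule mult_le_mono1)
      ultimately show "(n * d - B) * (n * d - B) \<le> card ?S" by linarith
    qed
    moreover have "finite (C \<sigma>)" using fin by (auto simp: C_def)
    ultimately show "finite (C \<sigma>) \<and> 2 * Suc l * (n * d - B)\<^sup>2 \<le> card (C \<sigma>)"
      using w(2) by (simp add: power2_eq_square)
  next
    fix \<tau> assume "\<tau> \<in> good_configs l"
    then show "finite (block_pairs \<times> vertex_pairs (fst \<circ> \<tau>)) \<and>
        card (block_pairs \<times> vertex_pairs (fst \<circ> \<tau>)) \<le> n * d * (k - 1) * (n * d * (d - 1))"
      by (auto simp: good_configs_def card_cartesian_product card_block_pairs card_vertex_pairs regular_word_config)
  next
    fix \<sigma> c assume \<sigma>: "\<sigma> \<in> good_configs (Suc l)" and c: "c \<in> C \<sigma>"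
    obtain p q r s where c_eq: "c = ((p, q), (r, s))" by (metis surj_pair)
    let ?w = "fst \<circ> \<sigma>"
    have l: "(p, q) \<in> loops ?w"
      and rs: "r \<in> positions" "s \<in> positions" "proper ?w (fst r)" "proper ?w (fst s)"
        "far ?w (fst p) (fst r)" "far ?w (fst p) (fst s)" "far ?w (fst r) (fst s)"
      using c by (auto simp: C_def c_eq avail_def)
    have pq: "p \<in> positions" "q \<in> positions" "p \<noteq> q" "fst p = fst q" "?w p = ?w q"
      using l by (auto simp: loops_def)
    have ne: "fst r \<noteq> fst p" "fst s \<noteq> fst p" "fst r \<noteq> fst s"
      using rs pq far_neq(2)[of ?w "fst p" "fst r" p r] far_neq(2)[of ?w "fst p" "fst s" p s]
        far_neq(2)[of ?w "fst r" "fst s" r s] by (auto simp: mem_positions_iff)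
    have "good l (fst \<circ> switch p q r s \<sigma>)"
      unfolding comp_switch using \<sigma> l rs
      by (intro good_switch_remove) (auto simp: good_configs_def)
    then have "switch p q r s \<sigma> \<in> good_configs l"
      using \<sigma> pq rs by (auto simp: good_configs_def intro: switch_configs)
    moreover have "(r, s) \<in> vertex_pairs (fst \<circ> switch p q r s \<sigma>)"
      using rs pq ne switch_apply[OF pq(3,4) ne, where f = \<sigma>] by (auto simp: vertex_pairs_def)
    ultimately show "g c \<sigma> \<in> good_configs l \<and> c \<in> block_pairs \<times> vertex_pairs (fst \<circ> g c \<sigma>) \<and> g c (g c \<sigma>) = \<sigma>"
      using pq switch_involutive[OF pq(3,4) ne] by (auto simp: g_def c_eq block_pairs_def)
  qed auto
qed

text \<open>The pair \<open>r\<close>, \<open>s\<close> of equal vertices is chosen first, then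
  \<open>p\<close> far from both of its blocks, then \<open>q\<close> beside \<open>p\<close>. For
  the inverse, \<open>r\<close> and \<open>s\<close> are arbitrary positions and
  \<open>(p, q)\<close> is one of the 2 (l + 1) ordered loops.\<close>

lemma creation_count:
  assumes B: "4 * k * l + 2 * k * (k * d)\<^sup>2 \<le> B"
  shows "((n * d - B)\<^sup>2 * (k - 1) * (d - 1)) * card (good_configs l)
    \<le> (2 * Suc l * (n * d)\<^sup>2) * card (good_configs (Suc l))"
proof -
  define avail where "avail w e f = {p \<in> positions. proper w (fst p) \<and> far w e (fst p) \<and> far w f (fst p)}"
    for w :: "nat \<times> nat \<Rightarrow> nat" and e f
  define pairs where "pairs w = {(r, s) \<in> vertex_pairs w. proper w (fst r) \<and> proper w (fst s)}"
    for w :: "nat \<times> nat \<Rightarrow> nat"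
  define C where "C \<sigma> = (SIGMA y:pairs (fst \<circ> \<sigma>).
      SIGMA p:avail (fst \<circ> \<sigma>) (fst (fst y)) (fst (snd y)). {q \<in> positions. q \<noteq> p \<and> fst q = fst p})"
    for \<sigma> :: "nat \<times> nat \<Rightarrow> nat \<times> nat"
  define g where "g = (\<lambda>((r, s), (p, q)). switch p q r s :: (nat \<times> nat \<Rightarrow> nat \<times> nat) \<Rightarrow> _)"
  have fin: "finite (avail w e f)" "finite (pairs w)" for w e f
    by (auto simp: avail_def pairs_def intro: finite_subset[of _ "vertex_pairs w"])
  show ?thesis
  proof (rule double_counting_le[where C = C and g = g and D = "\<lambda>\<tau>. (positions \<times> positions) \<times> loops (fst \<circ> \<tau>)"])
    fix \<sigma> assume \<sigma>: "\<sigma> \<in> good_configs l"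
    then have w: "regular_word (fst \<circ> \<sigma>)" "card (loops (fst \<circ> \<sigma>)) = 2 * l"
      by (auto simp: good_configs_def good_def regular_word_config)
    have B': "2 * k * l + 2 * k * (k * d)\<^sup>2 \<le> B" "4 * k * l \<le> B" using B by simp_all
    have av: "n * d - B \<le> card (avail (fst \<circ> \<sigma>) e f)" if "e < M" "f < M" for e f
      unfolding avail_def using card_far_positions[OF w that B'(1)] .
    have "card (pairs (fst \<circ> \<sigma>)) * ((n * d - B) * (k - 1)) \<le> card (C \<sigma>)"
      unfolding C_def
    proof (rule card_Sigma_ge[OF fin(2)], rule conjI)
      fix y assume "y \<in> pairs (fst \<circ> \<sigma>)"
      then have y: "fst (fst y) < M" "fst (snd y) < M"
        by (auto simp: pairs_def vertex_pairs_def positions_def)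
      let ?S = "SIGMA p:avail (fst \<circ> \<sigma>) (fst (fst y)) (fst (snd y)). {q \<in> positions. q \<noteq> p \<and> fst q = fst p}"
      show "finite ?S" using fin by auto
      have "card (avail (fst \<circ> \<sigma>) (fst (fst y)) (fst (snd y))) * (k - 1) \<le> card ?S"
        by (intro card_Sigma_ge fin conjI) (auto simp: avail_def card_block_partners)
      moreover have "(n * d - B) * (k - 1) \<le> card (avail (fst \<circ> \<sigma>) (fst (fst y)) (fst (snd y))) * (k - 1)"
        using av[OF y] by (rule mult_le_mono1)
      ultimately show "(n * d - B) * (k - 1) \<le> card ?S" by linarith
    qed
    moreover have "(n * d - B) * (d - 1) * ((n * d - B) * (k - 1)) \<le> card (pairs (fst \<circ> \<sigma>)) * ((n * d - B) * (k - 1))"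
      unfolding pairs_def using card_proper_vertex_pairs[OF w B'(2)] by (rule mult_le_mono1)
    moreover have "(n * d - B)\<^sup>2 * (k - 1) * (d - 1) = (n * d - B) * (d - 1) * ((n * d - B) * (k - 1))"
      by (simp add: power2_eq_square mult_ac)
    moreover have "finite (C \<sigma>)" using fin by (auto simp: C_def)
    ultimately show "finite (C \<sigma>) \<and> (n * d - B)\<^sup>2 * (k - 1) * (d - 1) \<le> card (C \<sigma>)"
      by linarith
  next
    fix \<tau> assume "\<tau> \<in> good_configs (Suc l)"
    then show "finite ((positions \<times> positions) \<times> loops (fst \<circ> \<tau>)) \<and>
        card ((positions \<times> positions) \<times> loops (fst \<circ> \<tau>)) \<le> 2 * Suc l * (n * d)\<^sup>2"
      by (auto simp: good_configs_def good_def card_cartesian_product power2_eq_square)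
  next
    fix \<sigma> c assume \<sigma>: "\<sigma> \<in> good_configs l" and c: "c \<in> C \<sigma>"
    obtain r s p q where c_eq: "c = ((r, s), (p, q))" by (metis surj_pair)
    let ?w = "fst \<circ> \<sigma>"
    have rs: "r \<in> positions" "s \<in> positions" "proper ?w (fst r)" "proper ?w (fst s)" "?w r = ?w s" "r \<noteq> s"
      and far: "far ?w (fst r) (fst p)" "far ?w (fst s) (fst p)"
      and pq: "p \<in> positions" "q \<in> positions" "p \<noteq> q" "fst p = fst q" "proper ?w (fst p)"
      using c by (auto simp: C_def c_eq avail_def pairs_def vertex_pairs_def)
    have ne: "fst r \<noteq> fst p" "fst s \<noteq> fst p"
      using rs pq far_neq(2)[OF far(1), of r p] far_neq(2)[OF far(2), of s p] by (auto simp: mem_positions_iff)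
    have ne': "fst r \<noteq> fst s"
    proof
      assume "fst r = fst s"
      then show False using rs inj_onD[of ?w "{fst r} \<times> {..<k}" r s]
        unfolding proper_def by (auto simp: mem_positions_iff)
    qed
    have "good (Suc l) (fst \<circ> switch p q r s \<sigma>)"
      unfolding comp_switch using \<sigma> pq rs ne' far_sym[OF far(1)] far_sym[OF far(2)]
      by (intro good_switch_create) (auto simp: good_configs_def)
    then have "switch p q r s \<sigma> \<in> good_configs (Suc l)"
      using \<sigma> pq rs by (auto simp: good_configs_def intro: switch_configs)
    moreover have "(p, q) \<in> loops (fst \<circ> switch p q r s \<sigma>)"
      using rs pq switch_apply[OF pq(3,4) ne ne', where f = \<sigma>] by (auto simp: loops_def)
    ultimately show "g c \<sigma> \<in> good_configs (Suc l) \<and> c \<in> (positions \<times> positions) \<times> loops (fst \<circ> g c \<sigma>) \<and> g c (g c \<sigma>) = \<sigma>"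
      using pq rs switch_involutive[OF pq(3,4) ne ne'] by (auto simp: g_def c_eq)
  qed auto
qed

subsection \<open>First moment estimates\<close>

definition coincide :: "((nat \<times> nat) \<times> (nat \<times> nat)) list \<Rightarrow> (nat \<times> nat \<Rightarrow> nat) \<Rightarrow> bool" where
  "coincide xs w \<longleftrightarrow> (\<forall>(r, s)\<in>set xs. w r = w s)"

text \<open>Each further coincidence costs a factor about \<open>1 / n\<close>: exchange the fresh position \<open>s\<close>
  with any position not yet used.\<close>

lemma card_coincide:
  assumes "fresh_pairs xs" "set xs \<subseteq> positions \<times> positions" "2 * length xs \<le> m"
  shows "(n * d - m) ^ length xs * card {\<sigma> \<in> configs. coincide xs (fst \<circ> \<sigma>)} \<le> d ^ length xs * fact (n * d)"
  using assms
proof (induction xs)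
  case Nil
  then show ?case by (simp add: coincide_def card_configs)
next
  case (Cons x xs)
  obtain r s where x: "x = (r, s)" by (cases x)
  define U where "U = insert r (fst ` set xs \<union> snd ` set xs)"
  have rs: "r \<in> positions" "s \<in> positions" "s \<notin> U" and U: "U \<subseteq> positions"
    using Cons.prems by (auto simp: x U_def)
  have finU: "finite U" by (simp add: U_def)
  have "card U \<le> Suc (card (fst ` set xs \<union> snd ` set xs))"
    unfolding U_def by (rule card_insert_le_m1) auto
  also have "card (fst ` set xs \<union> snd ` set xs) \<le> length xs + length xs"
    by (rule order.trans[OF card_Un_le]) (intro add_le_mono order.trans[OF card_image_le] card_length; simp)
  finally have cU: "card U \<le> m" using Cons.prems(3) by simp
  let ?A = "{\<sigma> \<in> configs. coincide (x # xs) (fst \<circ> \<sigma>)}" and ?B = "{\<sigma> \<in> configs. coincide xs (fst \<circ> \<sigma>)}"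
  have "(n * d - m) * card ?A \<le> d * card ?B"
  \<comment> \<open>With \<open>t\<close> outside \<open>U\<close> the remaining coincidences
    survive. Afterwards the vertex of \<open>r\<close> sits at \<open>t\<close>, so the inverse has
    only \<open>d\<close> candidates for \<open>t\<close>, against at least \<open>n * d - m\<close>
    forward.\<close>
  proof (rule double_counting_le[where C = "\<lambda>_. positions - U" and g = "swap_at s"
        and D = "\<lambda>\<tau>. {t \<in> positions. (fst \<circ> \<tau>) t = (fst \<circ> \<tau>) r}"])
    fix \<sigma> assume "\<sigma> \<in> ?A"
    show "finite (positions - U) \<and> n * d - m \<le> card (positions - U)"
      using card_Diff_subset[OF finU U] cU by auto
  next
    fix \<tau> assume "\<tau> \<in> ?B"
    then have "regular_word (fst \<circ> \<tau>)" by (simp add: regular_word_config)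
    then have "card {t \<in> positions. (fst \<circ> \<tau>) t = (fst \<circ> \<tau>) r} = d"
      using rs(1) unfolding regular_word_def by blast
    then show "finite {t \<in> positions. (fst \<circ> \<tau>) t = (fst \<circ> \<tau>) r} \<and>
        card {t \<in> positions. (fst \<circ> \<tau>) t = (fst \<circ> \<tau>) r} \<le> d" by simp
  next
    fix \<sigma> t assume \<sigma>: "\<sigma> \<in> ?A" and t: "t \<in> positions - U"
    have same: "swap_at s t \<sigma> u = \<sigma> u" if "u \<in> U" for u
      using that rs t by (auto simp: swap_at_def)
    have "coincide xs (fst \<circ> swap_at s t \<sigma>)"
      unfolding coincide_def
    proof (intro ballI, clarify)
      fix a b c e assume *: "((a, b), (c, e)) \<in> set xs"
      then have "(a, b) \<in> U" "(c, e) \<in> U" by (force simp: U_def)+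
      then show "(fst \<circ> swap_at s t \<sigma>) (a, b) = (fst \<circ> swap_at s t \<sigma>) (c, e)"
        using * \<sigma> same by (auto simp: coincide_def)
    qed
    moreover have "fst (swap_at s t \<sigma> t) = fst (swap_at s t \<sigma> r)"
    proof -
      have "swap_at s t \<sigma> t = \<sigma> s" by (simp add: swap_at_def)
      then show ?thesis using \<sigma> same[of r] by (simp add: coincide_def x U_def)
    qed
    ultimately show "swap_at s t \<sigma> \<in> ?B \<and> t \<in> {t' \<in> positions. (fst \<circ> swap_at s t \<sigma>) t' = (fst \<circ> swap_at s t \<sigma>) r}
        \<and> swap_at s t (swap_at s t \<sigma>) = \<sigma>"
      using \<sigma> rs t by (auto simp: swap_at_configs)
  qed auto
  then have "(n * d - m) ^ length xs * ((n * d - m) * card ?A) \<le> (n * d - m) ^ length xs * (d * card ?B)"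
    by (rule mult_le_mono2)
  also have "\<dots> = d * ((n * d - m) ^ length xs * card ?B)" by simp
  also have "\<dots> \<le> d * (d ^ length xs * fact (n * d))"
    using Cons.prems by (intro mult_le_mono2 Cons.IH) (auto simp: x)
  finally show ?case by (simp add: mult_ac comp_def)
qed

text \<open>At most half of the positions are excluded, so each factor
  \<open>d / (n * d - m)\<close> is at most 2 / n.\<close>

lemma card_coincide_real:
  assumes "fresh_pairs xs" "set xs \<subseteq> positions \<times> positions" "4 * length xs \<le> n * d"
  shows "real (card {\<sigma> \<in> configs. coincide xs (fst \<circ> \<sigma>)}) \<le> (2 / real n) ^ length xs * fact (n * d)"
proof (cases "xs = []")
  case True
  then show ?thesis by (simp add: coincide_def card_configs)
next
  case False
  then have "length xs \<ge> 1" by (cases xs) auto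
  with assms(3) have pos: "n > 0" "d > 0" by (auto intro!: Nat.gr0I)
  let ?c = "card {\<sigma> \<in> configs. coincide xs (fst \<circ> \<sigma>)}" and ?m = "length xs"
  have "real ((n * d - 2 * ?m) ^ ?m * ?c) \<le> real (d ^ ?m * fact (n * d))"
    using card_coincide[OF assms(1,2) order.refl] of_nat_mono by blast
  then have "real (n * d - 2 * ?m) ^ ?m * real ?c \<le> real d ^ ?m * fact (n * d)"
    by simp
  moreover have "(real n * real d / 2) ^ ?m \<le> real (n * d - 2 * ?m) ^ ?m"
    using assms(3) of_nat_mono[OF assms(3), where 'a = real]
    by (intro power_mono) (auto simp: of_nat_diff field_simps)
  ultimately have "(real n * real d / 2) ^ ?m * real ?c \<le> real d ^ ?m * fact (n * d)"
    by (meson mult_right_mono of_nat_0_le_iff order_trans)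
  then show ?thesis
    using pos by (simp add: field_simps power_mult_distrib power_divide)
qed

definition good_upto :: "nat \<Rightarrow> (nat \<times> nat \<Rightarrow> nat \<times> nat) set" where
  "good_upto L = (\<Union>l\<le>L. good_configs l)"

text \<open>Exchanging the ends is an involution without fixed points. Evenness ensures that the
  number of loops assigns a configuration to some class \<open>l\<close>.\<close>

lemma even_card_loops: "even (card (loops w))"
proof -
  let ?A = "{x \<in> loops w. snd (fst x) < snd (snd x)}"
  have "loops w = ?A \<union> prod.swap ` ?A"
  proof (intro set_eqI iffI)
    fix x assume x: "x \<in> loops w"
    then have "snd (fst x) \<noteq> snd (snd x)" by (auto simp: loops_def prod_eq_iff)
    moreover have "prod.swap x \<in> loops w" using x by (auto simp: loops_def)
    ultimately show "x \<in> ?A \<union> prod.swap ` ?A"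
      using x by (cases "snd (fst x) < snd (snd x)") (auto intro!: image_eqI[of _ _ "prod.swap x"])
  qed (auto simp: loops_def)
  moreover have "?A \<inter> prod.swap ` ?A = {}" by auto
  moreover have "card (prod.swap ` ?A) = card ?A" by (intro card_image) simp
  ultimately have "card (loops w) = 2 * card ?A"
    using card_Un_disjoint[of ?A "prod.swap ` ?A"] by simp
  then show ?thesis by simp
qed

text \<open>Markov's inequality: n d (k - 1) ordered pairs of slots, each a loop with probability at
  most 2 / n, give a mean of at most 2 k d, compared with the threshold
  \<open>2 * L\<close>.\<close>

lemma card_many_loops:
  assumes "4 \<le> n * d" "0 < L"
  shows "real (card {\<sigma> \<in> configs. 2 * L < card (loops (fst \<circ> \<sigma>))}) \<le> real k * real d / real L * fact (n * d)"
proof -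
  let ?X = "{\<sigma> \<in> configs. 2 * L < card (loops (fst \<circ> \<sigma>))}"
  have n0: "n > 0" using assms by (auto intro!: Nat.gr0I)
  have "card ?X * (2 * L) \<le> (\<Sum>\<sigma>\<in>?X. card (loops (fst \<circ> \<sigma>)))"
    using sum_bounded_below[of ?X "2 * L" "\<lambda>\<sigma>. card (loops (fst \<circ> \<sigma>))"] by simp
  also have "\<dots> \<le> (\<Sum>\<sigma>\<in>configs. card (loops (fst \<circ> \<sigma>)))"
    by (rule sum_mono2) auto
  also have "\<dots> = (\<Sum>\<sigma>\<in>configs. \<Sum>x\<in>block_pairs. if coincide [x] (fst \<circ> \<sigma>) then 1 else 0)"
  proof (rule sum.cong[OF refl])
    fix \<sigma>
    have "loops (fst \<circ> \<sigma>) = {x \<in> block_pairs. coincide [x] (fst \<circ> \<sigma>)}"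
      by (auto simp: loops_def block_pairs_def coincide_def)
    then show "card (loops (fst \<circ> \<sigma>)) = (\<Sum>x\<in>block_pairs. if coincide [x] (fst \<circ> \<sigma>) then 1 else 0)"
      by (simp add: sum.If_cases Int_def)
  qed
  also have "\<dots> = (\<Sum>x\<in>block_pairs. \<Sum>\<sigma>\<in>configs. if coincide [x] (fst \<circ> \<sigma>) then 1 else 0)"
    by (rule sum.swap)
  also have "\<dots> = (\<Sum>x\<in>block_pairs. card {\<sigma> \<in> configs. coincide [x] (fst \<circ> \<sigma>)})"
    by (simp add: sum.If_cases Int_def)
  finally have "real (card ?X * (2 * L)) \<le> real (\<Sum>x\<in>block_pairs. card {\<sigma> \<in> configs. coincide [x] (fst \<circ> \<sigma>)})"
    by (rule of_nat_mono)
  also have "\<dots> = (\<Sum>x\<in>block_pairs. real (card {\<sigma> \<in> configs. coincide [x] (fst \<circ> \<sigma>)}))"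
    by simp
  also have "\<dots> \<le> (\<Sum>x\<in>block_pairs. 2 / real n * fact (n * d))"
  proof (rule sum_mono)
    fix x assume "x \<in> block_pairs"
    then have "fresh_pairs [x]" "set [x] \<subseteq> positions \<times> positions" by (auto simp: block_pairs_def)
    from card_coincide_real[OF this] show "real (card {\<sigma> \<in> configs. coincide [x] (fst \<circ> \<sigma>)}) \<le> 2 / real n * fact (n * d)"
      using assms by simp
  qed
  also have "\<dots> = real (n * d * (k - 1)) * (2 / real n * fact (n * d))"
    by (simp only: sum_constant card_block_pairs)
  also have "\<dots> \<le> real (n * d * k) * (2 / real n * fact (n * d))"
    by (intro mult_right_mono of_nat_mono mult_le_mono2) auto
  also have "\<dots> = 2 * real k * real d * fact (n * d)"
    using n0 by simp
  finally show ?thesis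
    using assms(2) by (simp add: field_simps)
qed

lemma card_UN_coincide:
  assumes "finite I" "\<And>i. i \<in> I \<Longrightarrow> fresh_pairs (f i) \<and> set (f i) \<subseteq> positions \<times> positions \<and> length (f i) = m"
    and "4 * m \<le> n * d"
  shows "real (card (\<Union>i\<in>I. {\<sigma> \<in> configs. coincide (f i) (fst \<circ> \<sigma>)})) \<le> real (card I) * ((2 / real n) ^ m * fact (n * d))"
proof -
  have "real (card (\<Union>i\<in>I. {\<sigma> \<in> configs. coincide (f i) (fst \<circ> \<sigma>)})) \<le>
      real (\<Sum>i\<in>I. card {\<sigma> \<in> configs. coincide (f i) (fst \<circ> \<sigma>)})"
    using card_UN_le[OF assms(1)] of_nat_mono by blast
  also have "\<dots> \<le> (\<Sum>i\<in>I. (2 / real n) ^ m * fact (n * d))"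
    unfolding of_nat_sum
  proof (rule sum_mono)
    fix i assume "i \<in> I"
    then show "real (card {\<sigma> \<in> configs. coincide (f i) (fst \<circ> \<sigma>)}) \<le> (2 / real n) ^ m * fact (n * d)"
      using card_coincide_real[of "f i"] assms by auto
  qed
  finally show ?thesis by simp
qed

text \<open>Of two different loops in one block, the second has an end \<open>l\<close> outside the
  first, so it is a fresh coincidence even if the loops share the other end. There are at most M k^4
  = n d k^3 choices, each of probability at most (2 / n)^2.\<close>

lemma card_not_single_loops:
  assumes "8 \<le> n * d"
  shows "real (card {\<sigma> \<in> configs. \<not> single_loops (fst \<circ> \<sigma>)}) \<le> 4 * real k ^ 3 * real d / real n * fact (n * d)"
proof -
  have n0: "n > 0" using assms by (auto intro!: Nat.gr0I)
  define I where "I = {(b, h, i, j, l). b < M \<and> h < k \<and> i < k \<and> j < k \<and> l < k \<and> h \<noteq> i \<and> l \<noteq> h \<and> l \<noteq> i \<and> l \<noteq> j}"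
  define f where "f = (\<lambda>(b::nat, h::nat, i::nat, j::nat, l::nat). [((b, j), (b, l)), ((b, h), (b, i))])"
  have sub: "I \<subseteq> {..<M} \<times> {..<k} \<times> {..<k} \<times> {..<k} \<times> {..<k}" by (auto simp: I_def)
  have finI: "finite I" by (rule finite_subset[OF sub]) auto
  have "card I \<le> M * k ^ 4"
    using card_mono[OF _ sub] by (simp add: card_cartesian_product power4_eq_xxxx mult_ac)
  also have "M * k ^ 4 = k * M * k ^ 3"
    by (simp add: power4_eq_xxxx power3_eq_cube)
  also have "\<dots> = n * d * k ^ 3" unfolding kM ..
  finally have cI: "real (card I) \<le> real n * real d * real k ^ 3"
    using of_nat_mono[where 'a = real] by fastforce
  have "{\<sigma> \<in> configs. \<not> single_loops (fst \<circ> \<sigma>)} \<subseteq> (\<Union>i\<in>I. {\<sigma> \<in> configs. coincide (f i) (fst \<circ> \<sigma>)})"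
  proof
    fix \<sigma> assume "\<sigma> \<in> {\<sigma> \<in> configs. \<not> single_loops (fst \<circ> \<sigma>)}"
    then have \<sigma>: "\<sigma> \<in> configs" "\<not> single_loops (fst \<circ> \<sigma>)" by auto
    define w where "w = fst \<circ> \<sigma>"
    obtain x y where xy: "x \<in> loops w" "y \<in> loops w" "fst (fst x) = fst (fst y)" "y \<noteq> x" "y \<noteq> prod.swap x"
      using \<sigma>(2) unfolding single_loops_def w_def by blast
    obtain b h b' i c j c' l where x: "x = ((b, h), (b', i))" and y: "y = ((c, j), (c', l))"
      by (metis surj_pair)
    have eqs: "b' = b" "c = b" "c' = b" using xy(1-3) by (auto simp: x y loops_def)
    have "b < M" "h < k" "i < k" "h \<noteq> i" "w (b, h) = w (b, i)" "j < k" "l < k" "j \<noteq> l" "w (b, j) = w (b, l)"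
      using xy(1,2) by (auto simp: x y eqs loops_def positions_def)
    moreover have "(j, l) \<noteq> (h, i)" "(j, l) \<noteq> (i, h)" using xy(4,5) by (auto simp: x y eqs)
    ultimately have "(b, h, i, j, l) \<in> I \<and> coincide (f (b, h, i, j, l)) w \<or> (b, h, i, l, j) \<in> I \<and> coincide (f (b, h, i, l, j)) w"
      unfolding I_def f_def coincide_def by auto
    then show "\<sigma> \<in> (\<Union>i\<in>I. {\<sigma> \<in> configs. coincide (f i) (fst \<circ> \<sigma>)})"
      using \<sigma>(1) unfolding w_def by blast
  qed
  then have "real (card {\<sigma> \<in> configs. \<not> single_loops (fst \<circ> \<sigma>)}) \<le> real (card (\<Union>i\<in>I. {\<sigma> \<in> configs. coincide (f i) (fst \<circ> \<sigma>)}))"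
    using finI by (intro of_nat_mono card_mono) auto
  also have "\<dots> \<le> real (card I) * ((2 / real n) ^ 2 * fact (n * d))"
    by (rule card_UN_coincide[OF finI]) (use assms in \<open>auto simp: I_def f_def positions_def\<close>)
  also have "\<dots> \<le> real n * real d * real k ^ 3 * ((2 / real n) ^ 2 * fact (n * d))"
    using cI by (rule mult_right_mono) simp
  also have "\<dots> = 4 * real k ^ 3 * real d / real n * fact (n * d)"
    using n0 by (simp add: power2_eq_square field_simps)
  finally show ?thesis .
qed

text \<open>If \<open>b\<close> and \<open>c\<close> have the same support, each slot
  \<open>i\<close> of \<open>b\<close> repeats the vertex of some slot \<open>\<pi> i\<close> of
  \<open>c\<close>; loops may prevent \<open>\<pi>\<close> from being a permutation. These are
  \<open>k\<close> fresh coincidences for at most (n d)^2 pairs of blocks, hence the order d^2 /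
  n^(k - 2).\<close>

lemma card_multiple_edges:
  assumes "4 * k \<le> n * d"
  shows "real (card {\<sigma> \<in> configs. \<not> inj_on (vertex_set (fst \<circ> \<sigma>)) {..<M}})
    \<le> (real n * real d)\<^sup>2 * real k ^ k * (2 / real n) ^ k * fact (n * d)"
proof -
  define I where "I = {(b, c, \<pi>). b < M \<and> c < M \<and> b \<noteq> c \<and> \<pi> \<in> {..<k} \<rightarrow>\<^sub>E {..<k}}"
  define f where "f = (\<lambda>(b::nat, c::nat, \<pi>::nat \<Rightarrow> nat). map (\<lambda>i. ((c, \<pi> i), (b, i))) [0..<k])"
  have sub: "I \<subseteq> {..<M} \<times> {..<M} \<times> ({..<k} \<rightarrow>\<^sub>E {..<k})" by (auto simp: I_def)
  have fin: "finite ({..<M} \<times> {..<M} \<times> ({..<k} \<rightarrow>\<^sub>E {..<k}))" by (auto intro: finite_PiE)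
  have finI: "finite I" by (rule finite_subset[OF sub fin])
  have "card I \<le> M * M * k ^ k"
    using card_mono[OF fin sub] by (simp add: card_cartesian_product card_funcsetE)
  also have "M * M * k ^ k \<le> (n * d) * (n * d) * k ^ k"
  proof -
    have "1 * M \<le> k * M" using k3 by (intro mult_le_mono1) simp
    then have "M \<le> n * d" using kM by simp
    then show ?thesis by (intro mult_le_mono order.refl)
  qed
  finally have cI: "real (card I) \<le> (real n * real d)\<^sup>2 * real k ^ k"
    using of_nat_mono[where 'a = real] by (fastforce simp: power2_eq_square)
  have "{\<sigma> \<in> configs. \<not> inj_on (vertex_set (fst \<circ> \<sigma>)) {..<M}} \<subseteq> (\<Union>i\<in>I. {\<sigma> \<in> configs. coincide (f i) (fst \<circ> \<sigma>)})"
  proof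
    fix \<sigma> assume "\<sigma> \<in> {\<sigma> \<in> configs. \<not> inj_on (vertex_set (fst \<circ> \<sigma>)) {..<M}}"
    then have \<sigma>: "\<sigma> \<in> configs" "\<not> inj_on (vertex_set (fst \<circ> \<sigma>)) {..<M}" by auto
    then obtain b c where bc: "b < M" "c < M" "b \<noteq> c" "vertex_set (fst \<circ> \<sigma>) b = vertex_set (fst \<circ> \<sigma>) c"
      by (auto simp: inj_on_def)
    have "\<exists>j<k. (fst \<circ> \<sigma>) (b, i) = (fst \<circ> \<sigma>) (c, j)" if "i < k" for i
    proof -
      have "(fst \<circ> \<sigma>) (b, i) \<in> vertex_set (fst \<circ> \<sigma>) c"
        using bc(4) vertex_setI[of "(b, i)" b "fst \<circ> \<sigma>"] that by auto
      then show ?thesis by (auto simp: vertex_set_def)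
    qed
    then obtain \<pi> where \<pi>: "\<And>i. i < k \<Longrightarrow> \<pi> i < k \<and> (fst \<circ> \<sigma>) (b, i) = (fst \<circ> \<sigma>) (c, \<pi> i)"
      by metis
    have "(b, c, restrict \<pi> {..<k}) \<in> I" using bc \<pi> by (auto simp: I_def)
    moreover have "coincide (f (b, c, restrict \<pi> {..<k})) (fst \<circ> \<sigma>)"
      using \<pi> by (auto simp: coincide_def f_def)
    ultimately show "\<sigma> \<in> (\<Union>i\<in>I. {\<sigma> \<in> configs. coincide (f i) (fst \<circ> \<sigma>)})"
      using \<sigma>(1) by blast
  qed
  then have "real (card {\<sigma> \<in> configs. \<not> inj_on (vertex_set (fst \<circ> \<sigma>)) {..<M}}) \<le> real (card (\<Union>i\<in>I. {\<sigma> \<in> configs. coincide (f i) (fst \<circ> \<sigma>)}))"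
    using finI by (intro of_nat_mono card_mono) auto
  also have "\<dots> \<le> real (card I) * ((2 / real n) ^ k * fact (n * d))"
  proof (rule card_UN_coincide[OF finI _ assms])
    fix x assume "x \<in> I"
    then obtain b c \<pi> where x: "x = (b, c, \<pi>)" "b < M" "c < M" "b \<noteq> c" "\<And>i. i < k \<Longrightarrow> \<pi> i < k"
      by (auto simp: I_def PiE_iff)
    have fx: "f x = map (\<lambda>i. ((c, \<pi> i), (b, i))) [0..<k]" by (simp add: f_def x(1))
    have "set (f x) \<subseteq> positions \<times> positions"
      unfolding fx using x(2,3,5) by (auto simp: positions_def)
    then show "fresh_pairs (f x) \<and> set (f x) \<subseteq> positions \<times> positions \<and> length (f x) = k"
      using fresh_pairs_blocks[OF distinct_upt x(4)] by (simp add: fx)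
  qed
  also have "\<dots> \<le> (real n * real d)\<^sup>2 * real k ^ k * ((2 / real n) ^ k * fact (n * d))"
    using cI by (rule mult_right_mono) simp
  finally show ?thesis by (simp add: mult_ac)
qed

lemma card_good_upto:
  assumes "4 * k \<le> n * d" "0 < L"
  shows "fact (n * d) * (1 - (real k * real d / real L + 4 * real k ^ 3 * real d / real n
      + (real n * real d)\<^sup>2 * real k ^ k * (2 / real n) ^ k)) \<le> real (card (good_upto L))"
proof -
  let ?X = "{\<sigma> \<in> configs. 2 * L < card (loops (fst \<circ> \<sigma>))}"
    and ?Y = "{\<sigma> \<in> configs. \<not> single_loops (fst \<circ> \<sigma>)}"
    and ?Z = "{\<sigma> \<in> configs. \<not> inj_on (vertex_set (fst \<circ> \<sigma>)) {..<M}}"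
  have ge: "8 \<le> n * d" "4 \<le> n * d" using assms(1) k3 by auto
  have "configs \<subseteq> good_upto L \<union> (?X \<union> (?Y \<union> ?Z))"
  proof
    fix \<sigma> assume \<sigma>: "\<sigma> \<in> configs"
    show "\<sigma> \<in> good_upto L \<union> (?X \<union> (?Y \<union> ?Z))"
    proof (cases "\<sigma> \<in> ?X \<union> (?Y \<union> ?Z)")
      case False
      obtain l where l: "card (loops (fst \<circ> \<sigma>)) = 2 * l" using even_card_loops by (metis evenE)
      have "\<sigma> \<in> good_configs l" "l \<le> L"
        using False \<sigma> l by (auto simp: good_configs_def good_def)
      then show ?thesis by (auto simp: good_upto_def)
    qed auto
  qed
  then have "card configs \<le> card (good_upto L \<union> (?X \<union> (?Y \<union> ?Z)))"
    by (intro card_mono) (auto simp: good_upto_def)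
  also have "\<dots> \<le> card (good_upto L) + (card ?X + (card ?Y + card ?Z))"
    by (meson add_le_mono card_Un_le le_refl le_trans)
  finally have "real (card configs) \<le> real (card (good_upto L) + (card ?X + (card ?Y + card ?Z)))"
    by (rule of_nat_mono)
  then have "fact (n * d) \<le> real (card (good_upto L)) + (real (card ?X) + (real (card ?Y) + real (card ?Z)))"
    by (simp add: card_configs)
  with card_many_loops[OF ge(2) assms(2)] card_not_single_loops[OF ge(1)] card_multiple_edges[OF assms(1)]
  show ?thesis by (simp add: algebra_simps)
qed

lemma card_good_upto_sum: "card (good_upto L) = (\<Sum>l\<le>L. card (good_configs l))"
  unfolding good_upto_def by (rule card_UN_disjoint) (auto simp: good_configs_def good_def)

lemma card_good_upto_le: "card (good_upto L) \<le> fact (n * d)"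
  unfolding card_configs[symmetric] by (rule card_mono) (auto simp: good_upto_def good_configs_def)

subsection \<open>Regular hypergraphs as configurations without loops\<close>

definition simple_word :: "(nat \<times> nat \<Rightarrow> nat) \<Rightarrow> bool" where
  "simple_word w \<longleftrightarrow> (\<forall>b<M. proper w b) \<and> inj_on (vertex_set w) {..<M}"

lemma good_0_iff: "good 0 w \<longleftrightarrow> simple_word w"
proof -
  have "loops w = {} \<longleftrightarrow> (\<forall>b<M. proper w b)"
  proof
    assume pr: "\<forall>b<M. proper w b"
    have "x \<notin> loops w" for x
    proof
      assume x: "x \<in> loops w"
      then have "fst (fst x) < M" by (auto simp: loops_def positions_def)
      then show False using pr x proper_iff by blast
    qed
    then show "loops w = {}" by blast
  qed (simp add: proper_iff)
  then show ?thesis by (auto simp: good_def simple_word_def single_loops_def)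
qed

text \<open>Different blocks are different edges and a proper block holds \<open>v\<close> at most
  once, so the edges through \<open>v\<close> correspond to the positions of
  \<open>v\<close>.\<close>

lemma card_vertex_degree:
  assumes "simple_word w"
  shows "card {e \<in> vertex_set w ` {..<M}. v \<in> e} = card {p \<in> positions. w p = v}"
proof -
  have "bij_betw (\<lambda>p. vertex_set w (fst p)) {p \<in> positions. w p = v} {e \<in> vertex_set w ` {..<M}. v \<in> e}"
    unfolding bij_betw_def
  proof
    show "inj_on (\<lambda>p. vertex_set w (fst p)) {p \<in> positions. w p = v}"
    proof (rule inj_onI)
      fix p q assume p: "p \<in> {p \<in> positions. w p = v}" and q: "q \<in> {p \<in> positions. w p = v}"
        and eq: "vertex_set w (fst p) = vertex_set w (fst q)"
      have "fst p = fst q"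
        using assms p q eq unfolding simple_word_def by (auto simp: mem_positions_iff dest: inj_onD)
      then show "p = q"
        using assms p q inj_onD[of w "{fst p} \<times> {..<k}" p q]
        unfolding simple_word_def proper_def by (auto simp: mem_positions_iff)
    qed
    show "(\<lambda>p. vertex_set w (fst p)) ` {p \<in> positions. w p = v} = {e \<in> vertex_set w ` {..<M}. v \<in> e}"
    proof (intro set_eqI iffI)
      fix e assume "e \<in> (\<lambda>p. vertex_set w (fst p)) ` {p \<in> positions. w p = v}"
      then show "e \<in> {e \<in> vertex_set w ` {..<M}. v \<in> e}"
        using vertex_setI by (auto simp: mem_positions_iff)
    next
      fix e assume "e \<in> {e \<in> vertex_set w ` {..<M}. v \<in> e}"
      then obtain b i where "b < M" "i < k" "e = vertex_set w b" "w (b, i) = v"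
        by (auto simp: vertex_set_def)
      then show "e \<in> (\<lambda>p. vertex_set w (fst p)) ` {p \<in> positions. w p = v}"
        by (intro image_eqI[of _ _ "(b, i)"]) (auto simp: positions_def)
    qed
  qed
  then show ?thesis by (simp add: bij_betw_same_card)
qed

text \<open>Outside \<open>positions\<close> the word \<open>fst \<circ> \<sigma>\<close> has the
  value \<open>fst undefined\<close>, so it need not be extensional. The congruence rules allow
  replacing it by its restriction.\<close>

lemma vertex_set_cong:
  "(\<And>p. p \<in> positions \<Longrightarrow> w p = w' p) \<Longrightarrow> b < M \<Longrightarrow> vertex_set w b = vertex_set w' b"
  unfolding vertex_set_def by (rule image_cong) (auto simp: positions_def)

lemma simple_word_cong:
  assumes "\<And>p. p \<in> positions \<Longrightarrow> w p = w' p"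
  shows "simple_word w \<longleftrightarrow> simple_word w'"
proof -
  have "proper w b \<longleftrightarrow> proper w' b" if "b < M" for b
    unfolding proper_def using that assms by (intro inj_on_cong) (auto simp: positions_def)
  moreover have "inj_on (vertex_set w) {..<M} \<longleftrightarrow> inj_on (vertex_set w') {..<M}"
    using vertex_set_cong[of w w', OF assms] by (intro inj_on_cong) auto
  ultimately show ?thesis by (auto simp: simple_word_def)
qed

lemma edges_regular_hypergraph:
  assumes "regular_word w" "simple_word w"
  shows "vertex_set w ` {..<M} \<in> regular_hypergraphs k n d"
proof -
  have "vertex_set w b \<subseteq> {1..n} \<and> card (vertex_set w b) = k" if "b < M" for b
  proof
    show "vertex_set w b \<subseteq> {1..n}"
      using assms(1) that unfolding regular_word_def vertex_set_def positions_def by blast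
    show "card (vertex_set w b) = k"
      using assms(2) that by (simp add: vertex_set_def simple_word_def proper_def card_image)
  qed
  moreover have "card {e \<in> vertex_set w ` {..<M}. v \<in> e} = d" if "v \<in> {1..n}" for v
    using card_vertex_degree[OF assms(2), of v] assms(1) that by (simp add: regular_word_def)
  ultimately show ?thesis
    by (auto simp: regular_hypergraphs_def uniform_hypergraph_def regular_hypergraph_def)
qed

lemma regular_word_of_hypergraph:
  assumes "simple_word w" "vertex_set w ` {..<M} \<in> regular_hypergraphs k n d"
  shows "regular_word w"
proof -
  have "w p \<in> {1..n}" if "p \<in> positions" for p
  proof -
    have "w p \<in> vertex_set w (fst p)" "fst p < M" using that vertex_setI by (auto simp: mem_positions_iff)
    moreover have "vertex_set w (fst p) \<subseteq> {1..n}"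
      using assms(2) \<open>fst p < M\<close> by (simp add: regular_hypergraphs_def uniform_hypergraph_def)
    ultimately show ?thesis by blast
  qed
  moreover have "card {p \<in> positions. w p = v} = d" if "v \<in> {1..n}" for v
    using card_vertex_degree[OF assms(1), of v] assms(2) that
    by (simp add: regular_hypergraphs_def regular_hypergraph_def)
  ultimately show ?thesis by (auto simp: regular_word_def)
qed

lemma card_configs_of_word:
  assumes w: "regular_word w"
  shows "card {\<sigma> \<in> configs. \<forall>p\<in>positions. fst (\<sigma> p) = w p} = fact d ^ n"
proof -
  let ?A = "\<lambda>v. {p \<in> positions. w p = v}" and ?B = "\<lambda>v. {v} \<times> {..<d}"
  have UN: "(\<Union>v\<in>{1..n}. ?A v) = positions" using w unfolding regular_word_def by blast
  have cA: "card (?A v) = d" if "v \<in> {1..n}" for v using w that by (simp add: regular_word_def)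
  have "{\<sigma> \<in> configs. \<forall>p\<in>positions. fst (\<sigma> p) = w p} =
      {\<sigma> \<in> extensional (\<Union>v\<in>{1..n}. ?A v). \<forall>v\<in>{1..n}. bij_betw \<sigma> (?A v) (?B v)}"
    unfolding UN
  proof (intro set_eqI iffI)
    fix \<sigma> assume "\<sigma> \<in> {\<sigma> \<in> configs. \<forall>p\<in>positions. fst (\<sigma> p) = w p}"
    then have \<sigma>: "inj_on \<sigma> positions" "\<sigma> ` positions = points" "\<sigma> \<in> extensional positions"
      and fst: "\<And>p. p \<in> positions \<Longrightarrow> fst (\<sigma> p) = w p"
      by (auto simp: configs_def bijections_def bij_betw_def PiE_iff)
    have "bij_betw \<sigma> (?A v) (?B v)" if v: "v \<in> {1..n}" for v
    proof -
      have "\<sigma> ` ?A v = {x \<in> \<sigma> ` positions. fst x = v}" using fst by auto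
      also have "\<dots> = ?B v" using v by (auto simp: \<sigma>(2) points_def)
      finally show ?thesis using inj_on_subset[OF \<sigma>(1)] by (auto simp: bij_betw_def)
    qed
    then show "\<sigma> \<in> {\<sigma> \<in> extensional positions. \<forall>v\<in>{1..n}. bij_betw \<sigma> (?A v) (?B v)}"
      using \<sigma> by auto
  next
    fix \<sigma> assume "\<sigma> \<in> {\<sigma> \<in> extensional positions. \<forall>v\<in>{1..n}. bij_betw \<sigma> (?A v) (?B v)}"
    then have ext: "\<sigma> \<in> extensional positions" and im: "\<And>v. v \<in> {1..n} \<Longrightarrow> \<sigma> ` ?A v = ?B v"
      by (auto simp: bij_betw_def)
    have "\<sigma> ` positions = (\<Union>v\<in>{1..n}. \<sigma> ` ?A v)" by (subst UN[symmetric]) (rule image_UN)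
    also have "\<dots> = (\<Union>v\<in>{1..n}. ?B v)" using im by (rule SUP_cong[OF refl])
    also have "\<dots> = points" by (auto simp: points_def)
    finally have img: "\<sigma> ` positions = points" .
    then have "inj_on \<sigma> positions" by (intro eq_card_imp_inj_on) auto
    moreover have "fst (\<sigma> p) = w p" if p: "p \<in> positions" for p
    proof -
      have "w p \<in> {1..n}" using w p by (auto simp: regular_word_def)
      then have "\<sigma> p \<in> ?B (w p)" using im[of "w p"] p by blast
      then show ?thesis by auto
    qed
    ultimately show "\<sigma> \<in> {\<sigma> \<in> configs. \<forall>p\<in>positions. fst (\<sigma> p) = w p}"
      using ext img by (auto simp: configs_def bijections_def bij_betw_def PiE_iff)
  qed
  also have "card \<dots> = (\<Prod>v\<in>{1..n}. fact (card (?A v)))"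
    by (rule card_fibrewise_bijections) (auto simp: cA disjoint_family_on_def)
  finally show ?thesis by (simp add: cA)
qed

text \<open>\<open>\<tau>\<close> distributes the \<open>M\<close> edges over the blocks, and each
  block then lists its edge in one of k! orders. A word recovers \<open>\<tau>\<close> as its
  \<open>vertex_set\<close>, so the families \<open>?F \<tau>\<close> are disjoint.\<close>

lemma card_words_of_hypergraph:
  assumes E: "E \<in> regular_hypergraphs k n d"
  shows "card {w \<in> extensional positions. simple_word w \<and> vertex_set w ` {..<M} = E} = fact M * fact k ^ M"
    (is "card ?W = _")
proof -
  have "k * card E = k * M" using card_edges_regular_hypergraph[OF E] kM by simp
  then have cE: "card E = M" using k3 by simp
  have "E \<subseteq> Pow {1..n}" using E by (auto simp: regular_hypergraphs_def uniform_hypergraph_def)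
  then have finE: "finite E" by (rule finite_subset) simp
  have ck: "card e = k" "finite e" if "e \<in> E" for e
  proof -
    show "card e = k" using E that by (auto simp: regular_hypergraphs_def uniform_hypergraph_def)
    then show "finite e" using k3 card.infinite[of e] by auto
  qed
  have UN: "(\<Union>b\<in>{..<M}. {b} \<times> {..<k}) = positions" by (auto simp: positions_def)
  let ?F = "\<lambda>\<tau>. {w \<in> extensional positions. \<forall>b\<in>{..<M}. bij_betw w ({b} \<times> {..<k}) (\<tau> b)}"
  have F: "vertex_set w b = \<tau> b" if "w \<in> ?F \<tau>" "b < M" for w \<tau> b
    using that by (auto simp: vertex_set_def bij_betw_def)
  have W: "?W = (\<Union>\<tau>\<in>bijections {..<M} E. ?F \<tau>)"
  proof (intro set_eqI iffI)
    fix w assume w: "w \<in> ?W"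
    then have "restrict (vertex_set w) {..<M} \<in> bijections {..<M} E"
      by (auto simp: bijections_def bij_betw_def simple_word_def inj_on_def)
    moreover have "w \<in> ?F (restrict (vertex_set w) {..<M})"
      using w by (auto simp: bij_betw_def simple_word_def proper_def vertex_set_def)
    ultimately show "w \<in> (\<Union>\<tau>\<in>bijections {..<M} E. ?F \<tau>)" by blast
  next
    fix w assume "w \<in> (\<Union>\<tau>\<in>bijections {..<M} E. ?F \<tau>)"
    then obtain \<tau> where \<tau>: "bij_betw \<tau> {..<M} E" and w: "w \<in> ?F \<tau>"
      by (auto simp: bijections_def)
    have "inj_on (vertex_set w) {..<M}" "vertex_set w ` {..<M} = E"
      using \<tau> F[OF w] by (auto simp: bij_betw_def inj_on_def)
    then show "w \<in> ?W"
      using w by (auto simp: simple_word_def proper_def bij_betw_def)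
  qed
  have cF: "card (?F \<tau>) = fact k ^ M" if "\<tau> \<in> bijections {..<M} E" for \<tau>
  proof -
    have "\<And>b. b < M \<Longrightarrow> \<tau> b \<in> E" using that by (auto simp: bijections_def)
    then have "card (?F \<tau>) = (\<Prod>b\<in>{..<M}. fact (card ({b} \<times> {..<k})))"
      unfolding UN[symmetric] using ck
      by (intro card_fibrewise_bijections) (auto simp: disjoint_family_on_def)
    then show ?thesis by simp
  qed
  have disj: "?F \<tau> \<inter> ?F \<tau>' = {}"
    if t: "\<tau> \<in> bijections {..<M} E" "\<tau>' \<in> bijections {..<M} E" "\<tau> \<noteq> \<tau>'" for \<tau> \<tau>'
  proof (rule ccontr)
    assume "?F \<tau> \<inter> ?F \<tau>' \<noteq> {}"
    then obtain w where w: "w \<in> ?F \<tau>" "w \<in> ?F \<tau>'" by blast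
    have "\<tau> \<in> extensional {..<M}" "\<tau>' \<in> extensional {..<M}"
      using t by (auto simp: bijections_def PiE_iff)
    then have "\<tau> = \<tau>'" using F[OF w(1)] F[OF w(2)] by (intro extensionalityI[of _ "{..<M}"]) auto
    then show False using t(3) by simp
  qed
  have fin: "finite (?F \<tau>)" if "\<tau> \<in> bijections {..<M} E" for \<tau>
    by (rule card_ge_0_finite) (simp add: cF[OF that])
  have "card ?W = card (\<Union>\<tau>\<in>bijections {..<M} E. ?F \<tau>)" using W by (rule arg_cong)
  also have "\<dots> = (\<Sum>\<tau>\<in>bijections {..<M} E. card (?F \<tau>))"
    using finE disj fin by (intro card_UN_disjoint) (auto intro: finite_bijections)
  also have "\<dots> = (\<Sum>\<tau>\<in>bijections {..<M} E. fact k ^ M)" using cF by (rule sum.cong[OF refl])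
  finally have "card ?W = (\<Sum>\<tau>\<in>bijections {..<M} E. fact k ^ M)" .
  then show ?thesis using finE cE by (simp add: card_bijections)
qed

text \<open>Forgetting the copies leads to a word, forgetting the order of blocks and slots to a
  hypergraph. All fibres of a step have the same size, (d!)^n and M! (k!)^M. Words are taken
  extensional so that every configuration lies over exactly one.\<close>

lemma card_good_configs_0:
  "card (good_configs 0) = card (regular_hypergraphs k n d) * (fact M * fact k ^ M * fact d ^ n)"
proof -
  let ?H = "regular_hypergraphs k n d"
  let ?W = "\<lambda>E. {w \<in> extensional positions. simple_word w \<and> vertex_set w ` {..<M} = E}"
  let ?S = "\<lambda>w. {\<sigma> \<in> configs. \<forall>p\<in>positions. fst (\<sigma> p) = w p}"
  have finW: "finite (?W E)" if "E \<in> ?H" for E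
    by (rule card_ge_0_finite) (simp add: card_words_of_hypergraph[OF that])
  have eq: "good_configs 0 = (\<Union>x\<in>Sigma ?H ?W. ?S (snd x))"
  proof (intro set_eqI iffI)
    fix \<sigma> assume "\<sigma> \<in> good_configs 0"
    then have \<sigma>: "\<sigma> \<in> configs" "simple_word (fst \<circ> \<sigma>)" by (auto simp: good_configs_def good_0_iff)
    define w where "w = restrict (fst \<circ> \<sigma>) positions"
    have weq: "\<And>p. p \<in> positions \<Longrightarrow> w p = (fst \<circ> \<sigma>) p" by (simp add: w_def)
    have sw: "simple_word w" using simple_word_cong[of w "fst \<circ> \<sigma>", OF weq] \<sigma>(2) by simp
    have "vertex_set w ` {..<M} = vertex_set (fst \<circ> \<sigma>) ` {..<M}"
      using vertex_set_cong[of w "fst \<circ> \<sigma>", OF weq] by (intro image_cong refl) simp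
    then have "(vertex_set w ` {..<M}, w) \<in> Sigma ?H ?W"
      using edges_regular_hypergraph[OF regular_word_config[OF \<sigma>(1)] \<sigma>(2)] sw
      by (auto simp: w_def)
    moreover have "\<sigma> \<in> ?S (snd (vertex_set w ` {..<M}, w))" using \<sigma> by (simp add: w_def)
    ultimately show "\<sigma> \<in> (\<Union>x\<in>Sigma ?H ?W. ?S (snd x))" by (rule UN_I)
  next
    fix \<sigma> assume "\<sigma> \<in> (\<Union>x\<in>Sigma ?H ?W. ?S (snd x))"
    then obtain x where x: "x \<in> Sigma ?H ?W" and w: "\<sigma> \<in> ?S (snd x)" by (rule UN_E)
    have "simple_word (snd x)" using x by auto
    then have "simple_word (fst \<circ> \<sigma>)" using simple_word_cong[of "fst \<circ> \<sigma>" "snd x"] w by simp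
    then show "\<sigma> \<in> good_configs 0" using w by (simp add: good_configs_def good_0_iff)
  qed
  have "card (good_configs 0) = card (\<Union>x\<in>Sigma ?H ?W. ?S (snd x))"
    by (rule arg_cong[OF eq])
  also have "\<dots> = (\<Sum>x\<in>Sigma ?H ?W. card (?S (snd x)))"
  proof (rule card_UN_disjoint)
    show "finite (Sigma ?H ?W)" using finW finite_regular_hypergraphs by blast
    show "\<forall>x\<in>Sigma ?H ?W. \<forall>y\<in>Sigma ?H ?W. x \<noteq> y \<longrightarrow> ?S (snd x) \<inter> ?S (snd y) = {}"
    proof (intro ballI impI, rule ccontr)
      fix x y assume xy: "x \<in> Sigma ?H ?W" "y \<in> Sigma ?H ?W" "x \<noteq> y" and "?S (snd x) \<inter> ?S (snd y) \<noteq> {}"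
      then obtain \<sigma> where "\<sigma> \<in> ?S (snd x)" "\<sigma> \<in> ?S (snd y)" by blast
      then have "snd x p = snd y p" if "p \<in> positions" for p using that by (metis (mono_tags, lifting) mem_Collect_eq)
      moreover have "snd x \<in> extensional positions" "snd y \<in> extensional positions" using xy by auto
      ultimately have "snd x = snd y" by (intro extensionalityI[of _ positions]) auto
      then show False using xy by auto
    qed
  qed auto
  also have "\<dots> = (\<Sum>x\<in>Sigma ?H ?W. fact d ^ n)"
  proof (rule sum.cong[OF refl])
    fix x assume "x \<in> Sigma ?H ?W"
    then obtain E w where x: "x = (E, w)" "E \<in> ?H" "w \<in> ?W E" by (rule SigmaE)
    have "regular_word w" using x(2,3) regular_word_of_hypergraph[of w] by simp
    then have "regular_word (snd x)" using x(1) by simp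
    then show "card (?S (snd x)) = fact d ^ n" by (rule card_configs_of_word)
  qed
  also have "\<dots> = card (Sigma ?H ?W) * fact d ^ n" by simp
  finally have 1: "card (good_configs 0) = card (Sigma ?H ?W) * fact d ^ n" .
  have "card (Sigma ?H ?W) = (\<Sum>E\<in>?H. card (?W E))"
    using finW finite_regular_hypergraphs by (intro card_SigmaI) auto
  also have "\<dots> = (\<Sum>E\<in>?H. fact M * fact k ^ M)"
    by (rule sum.cong[OF refl]) (rule card_words_of_hypergraph)
  also have "\<dots> = card ?H * (fact M * fact k ^ M)" by simp
  finally show ?thesis using 1 by (simp only: mult.assoc)
qed

subsection \<open>The probability of simplicity\<close>

definition simple_probability :: real where
  "simple_probability = real (card (good_configs 0)) / fact (n * d)"

text \<open>\<open>B\<close> bounds the spoilt positions for every class below \<open>L\<close>, so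
  one \<open>\<beta>\<close> serves all ratios; two choices per switching lose the factor 1 -
  \<beta>. The summands of \<open>\<eta>\<close> account for too many loops, two loops in a block
  and coinciding blocks.\<close>

lemma ln_simple_probability:
  fixes L B :: nat
  defines "x \<equiv> (real k - 1) * (real d - 1) / 2"
    and "\<eta> \<equiv> real k * real d / real L + 4 * real k ^ 3 * real d / real n
      + (real n * real d)\<^sup>2 * real k ^ k * (2 / real n) ^ k"
    and "\<beta> \<equiv> real B / (real n * real d)"
  assumes "0 < n" "0 < L" "4 * k \<le> n * d" and B: "4 * k * L + 2 * k * (k * d)\<^sup>2 \<le> B"
    and small: "\<eta> \<le> 1 / 2" "\<beta> \<le> 1 / 4" "x / real L \<le> 1 / 2"
  shows "0 < simple_probability"
    and "\<bar>ln simple_probability + x\<bar> \<le> 2 * \<eta> + 4 * (x * \<beta>) + 2 * (x / real L)"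
proof -
  define N where "N = real n * real d"
  define a where "a l = real (card (good_configs l))" for l
  have N: "0 < N" using assms(4) d1 by (simp add: N_def)
  have x0: "0 \<le> x" using k3 d1 by (simp add: x_def)
  have \<beta>0: "0 \<le> \<beta>" by (simp add: \<beta>_def)
  have \<eta>0: "0 \<le> \<eta>" by (simp add: \<eta>_def)
  \<comment> \<open>This rules out truncation in the natural number
    \<open>n * d - B\<close>.\<close>
  have "real B \<le> N" using small(2) N by (simp add: \<beta>_def N_def field_simps)
  then have BN: "B \<le> n * d" unfolding N_def by (simp flip: of_nat_mult)
  have NB: "real (n * d - B) = N * (1 - \<beta>)"
  proof -
    have "N * (1 - \<beta>) = N - real B" using N by (simp add: \<beta>_def N_def[symmetric] right_diff_distrib)
    then show ?thesis using BN by (simp add: of_nat_diff N_def)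
  qed
  have \<theta>: "0 < (1 - \<beta>)\<^sup>2" using small(2) by simp
  have xx: "real (k - 1) * real (d - 1) = 2 * x" using k3 d1 by (simp add: x_def of_nat_diff)
  have up: "real (Suc l) * (1 - \<beta>)\<^sup>2 * a (Suc l) \<le> x * a l" if "l < L" for l
  proof -
    have "4 * k * Suc l \<le> 4 * k * L" using that by (intro mult_le_mono2) simp
    then have "4 * k * Suc l + 2 * k * (k * d)\<^sup>2 \<le> B" using B by linarith
    from of_nat_mono[OF removal_count[OF this], where 'a = real]
    have "2 * real (Suc l) * (real (n * d - B))\<^sup>2 * a (Suc l) \<le> N\<^sup>2 * (real (k - 1) * real (d - 1)) * a l"
      unfolding of_nat_mult of_nat_power of_nat_numeral a_def N_def power2_eq_square by (simp only: mult_ac)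
    then have "(2 * N\<^sup>2) * (real (Suc l) * (1 - \<beta>)\<^sup>2 * a (Suc l)) \<le> (2 * N\<^sup>2) * (x * a l)"
      unfolding NB xx by (simp add: power_mult_distrib mult_ac del: of_nat_Suc)
    then show ?thesis using N by (subst (asm) mult_le_cancel_left_pos) auto
  qed
  have low: "x * (1 - \<beta>)\<^sup>2 * a l \<le> real (Suc l) * a (Suc l)" if "l < L" for l
  proof -
    have "4 * k * l \<le> 4 * k * L" using that by (intro mult_le_mono2) simp
    then have "4 * k * l + 2 * k * (k * d)\<^sup>2 \<le> B" using B by linarith
    from of_nat_mono[OF creation_count[OF this], where 'a = real]
    have "(real (n * d - B))\<^sup>2 * (real (k - 1) * real (d - 1)) * a l \<le> 2 * real (Suc l) * N\<^sup>2 * a (Suc l)"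
      unfolding of_nat_mult of_nat_power of_nat_numeral a_def N_def power2_eq_square by (simp only: mult_ac)
    then have "(2 * N\<^sup>2) * (x * (1 - \<beta>)\<^sup>2 * a l) \<le> (2 * N\<^sup>2) * (real (Suc l) * a (Suc l))"
      unfolding NB xx by (simp add: power_mult_distrib mult_ac del: of_nat_Suc)
    then show ?thesis using N by (subst (asm) mult_le_cancel_left_pos) auto
  qed
  have S: "(\<Sum>l\<le>L. a l) = real (card (good_upto L))"
    by (simp add: a_def card_good_upto_sum)
  note sandwich = ratio_sandwich[of a x "(1 - \<beta>)\<^sup>2" L, OF _ x0 \<theta> up low, unfolded S]
  have r: "simple_probability = a 0 / fact (n * d)" by (simp add: simple_probability_def a_def)
  have "fact (n * d) * (1 - \<eta>) \<le> real (card (good_upto L))"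
    using card_good_upto[OF assms(6,5)] by (simp add: \<eta>_def)
  also have "\<dots> \<le> a 0 * exp (x / (1 - \<beta>)\<^sup>2)" by (rule sandwich(1)) (auto simp: a_def)
  finally have 1: "1 - \<eta> \<le> simple_probability * exp (x / (1 - \<beta>)\<^sup>2)"
    by (simp add: r field_simps)
  have "a 0 * (exp (x * (1 - \<beta>)\<^sup>2) * (1 - x * (1 - \<beta>)\<^sup>2 / Suc L)) \<le> real (card (good_upto L))"
    by (rule sandwich(2)) (auto simp: a_def)
  also have "\<dots> \<le> fact (n * d)" using of_nat_mono[OF card_good_upto_le, where 'a = real] by simp
  finally have 2: "simple_probability * (exp (x * (1 - \<beta>)\<^sup>2) * (1 - x * (1 - \<beta>)\<^sup>2 / real (Suc L))) \<le> 1"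
    unfolding r times_divide_eq_left by (subst divide_le_eq_1_pos[OF fact_gt_zero])
  have le: "x / real (Suc L) \<le> x / real L"
    using x0 assms(5) by (intro divide_left_mono) auto
  then have half: "x / real (Suc L) \<le> 1 / 2" using small(3) by linarith
  have Suc_pos: "0 < real (Suc L)" by simp
  note bounds = ln_ratio_bound[OF x0 \<beta>0 small(2) \<eta>0 small(1) Suc_pos half 1 2]
  show "0 < simple_probability" by (rule bounds(1))
  show "\<bar>ln simple_probability + x\<bar> \<le> 2 * \<eta> + 4 * (x * \<beta>) + 2 * (x / real L)"
    using bounds(2) le by linarith
qed

lemma card_regular_hypergraphs:
  "real (card (regular_hypergraphs k n d)) =
    fact (n * d) / (fact M * fact k ^ M * fact d ^ n) * simple_probability"
proof -
  define D :: real where "D = fact M * fact k ^ M * fact d ^ n"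
  have "real (card (good_configs 0)) = real (card (regular_hypergraphs k n d)) * D"
    by (simp only: card_good_configs_0 D_def of_nat_mult of_nat_power of_nat_fact)
  moreover have "D \<noteq> 0" by (simp add: D_def)
  ultimately show ?thesis unfolding simple_probability_def D_def[symmetric] by simp
qed

lemma simple_probability_estimate:
  defines "s \<equiv> sqrt (real d / real n)"
  assumes n: "0 < n" and s: "s \<le> 1 / (32 * real k ^ 3)"
    and T: "(2 * real k) ^ k * (real d)\<^sup>2 * (real n)\<^sup>2 / real n ^ k \<le> 1 / 8"
  shows "0 < simple_probability"
    and "\<bar>ln simple_probability + (real k - 1) * (real d - 1) / 2\<bar>
      \<le> (10 * real k + 8 * real k ^ 3 + 2 * (2 * real k) ^ k + 8 * real k ^ 2 + 4 * real k ^ 4)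
        * (s + (real d)\<^sup>2 / real n)"
proof -
  define K where "K = real k"
  define R where "R = sqrt (real n * real d)"
  \<comment> \<open>This size balances two errors: the discarded proportion k d / L and the effect x
    L / (n d) of the loops on the ratios are both of order sqrt(d / n).\<close>
  define L where "L = nat \<lfloor>R\<rfloor>"
  define B where "B = 4 * k * L + 2 * k * (k * d)\<^sup>2"
  define D where "D = (real d)\<^sup>2 / real n"
  define x where "x = (real k - 1) * (real d - 1) / 2"
  define \<eta> where "\<eta> = real k * real d / real L + 4 * real k ^ 3 * real d / real n
      + (real n * real d)\<^sup>2 * real k ^ k * (2 / real n) ^ k"
  define \<beta> where "\<beta> = real B / (real n * real d)"
  have K: "3 \<le> K" using k3 by (simp add: K_def)
  have d: "1 \<le> real d" using d1 by simp
  have nr: "1 \<le> real n" using n by simp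
  have RR: "R * R = real n * real d" by (simp add: R_def)
  have R1: "1 \<le> R" using nr d mult_mono[of 1 "real n" 1 "real d"] by (simp add: R_def)
  have "0 \<le> s" by (simp add: s_def)
  have ss: "s * s = real d / real n" by (simp add: s_def)
  have sR: "s * R = real d" using n by (simp add: s_def R_def flip: real_sqrt_mult)
  \<comment> \<open>Rounding down costs at most a factor 2, since R < L + 1 \<le> 2 L.\<close>
  have L: "R / 2 \<le> real L" "real L \<le> R" "0 < L"
  proof -
    have "1 \<le> \<lfloor>R\<rfloor>" using R1 by (simp add: le_floor_iff)
    then have "real L = of_int \<lfloor>R\<rfloor>" "1 \<le> real L" "0 < L" by (auto simp: L_def)
    then show "R / 2 \<le> real L" "real L \<le> R" "0 < L" using floor_correct[of R] by linarith+
  qed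
  have K3: "K \<le> K ^ 3" "1 \<le> K ^ 3" "1 \<le> K"
    using K power_increasing[of 1 3 K] one_le_power[of K 3] by auto
  \<comment> \<open>The tightest use of 32 is for \<open>\<beta>\<close>, whose bound 4 K s + 2 K^3
    s becomes 6/32 and so stays below 1/4.\<close>
  have s': "32 * K ^ 3 * s \<le> 1" using s K by (simp add: K_def field_simps)
  have Ks: "32 * (K * s) \<le> 1" "32 * (K ^ 3 * s) \<le> 1" "32 * s \<le> 1"
    using s' mult_right_mono[OF K3(1) \<open>0 \<le> s\<close>] mult_right_mono[OF K3(2) \<open>0 \<le> s\<close>] by auto
  have s1: "s \<le> 1" using Ks(3) \<open>0 \<le> s\<close> by linarith
  have s2: "s * s \<le> s" using s1 \<open>0 \<le> s\<close> by (simp add: mult_left_le)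
  have K3ss: "K ^ 3 * (s * s) \<le> K ^ 3 * s" using s2 K by (intro mult_left_mono) auto
  have D0: "0 \<le> D" by (simp add: D_def)
  have dss: "real d * (s * s) = D" by (simp add: ss D_def power2_eq_square)
  have dR: "real d / R = s" using sR R1 by (simp add: field_simps)
  have invR: "1 / R \<le> s" using dR d R1 divide_right_mono[of 1 "real d" R] by simp
  have x: "0 \<le> x" "2 * x \<le> K * real d"
    using K d mult_mono[of "K - 1" K "real d - 1" "real d"] by (simp_all add: x_def flip: K_def)
  have dL: "real d / real L \<le> 2 * s"
  proof -
    have "real d / real L \<le> real d / (R / 2)" using L R1 d by (intro divide_left_mono) auto
    also have "\<dots> = 2 * (real d / R)" by simp
    finally show ?thesis unfolding dR .
  qed
  have xL: "x / real L \<le> K * s"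
  proof -
    have "x / real L \<le> K * (real d / real L) / 2" using x L by (simp add: field_simps)
    also have "\<dots> \<le> K * (2 * s) / 2" using dL K by (intro divide_right_mono mult_left_mono) auto
    finally show ?thesis by simp
  qed
  have \<beta>: "\<beta> \<le> 4 * K / R + 2 * K ^ 3 * (s * s)"
  proof -
    have "\<beta> = (4 * K * real L) / (R * R) + 2 * K ^ 3 * (real d / real n)"
      using n d by (simp add: \<beta>_def B_def RR K_def add_divide_distrib power2_eq_square power3_eq_cube)
    also have "\<dots> \<le> (4 * K * R) / (R * R) + 2 * K ^ 3 * (real d / real n)"
      using L K R1 by (intro add_right_mono divide_right_mono mult_left_mono) auto
    finally show ?thesis using R1 by (simp add: ss)
  qed
  have "4 * K / R \<le> 4 * K * s" using invR K mult_left_mono[of "1 / R" s "4 * K"] by simp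
  then have \<beta>4: "\<beta> \<le> 1 / 4" using \<beta> K3ss Ks by linarith
  have x\<beta>: "x * \<beta> \<le> 2 * K\<^sup>2 * s + K ^ 4 * D"
  proof -
    have "x * \<beta> \<le> x * (4 * K / R + 2 * K ^ 3 * (s * s))" using \<beta> x(1) by (rule mult_left_mono)
    also have "\<dots> \<le> (K * real d / 2) * (4 * K / R + 2 * K ^ 3 * (s * s))"
      using x K R1 \<open>0 \<le> s\<close> by (intro mult_right_mono) auto
    also have "\<dots> = 2 * K\<^sup>2 * (real d / R) + K ^ 4 * (real d * (s * s))"
      by (simp add: field_simps power2_eq_square power3_eq_cube power4_eq_xxxx)
    finally show ?thesis by (simp add: dR dss)
  qed
  define T' where "T' = (real n * real d)\<^sup>2 * real k ^ k * (2 / real n) ^ k"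
  have T'_eq: "T' = (2 * K) ^ k * (real d)\<^sup>2 * (real n)\<^sup>2 / real n ^ k"
    by (simp add: T'_def K_def power_mult_distrib power_divide mult_ac)
  have T'8: "T' \<le> 1 / 8" using T by (simp add: T'_eq K_def)
  have T'D: "T' \<le> (2 * K) ^ k * D"
  proof -
    \<comment> \<open>By k \<ge> 3 the coinciding blocks, of order d^2 / n^(k - 2), are absorbed
      into d^2 / n.\<close>
    have "(real n)\<^sup>2 * real n \<le> real n ^ k"
      using power_increasing[OF k3 nr] by (simp add: power2_eq_square power3_eq_cube)
    then have "(real n)\<^sup>2 / real n ^ k \<le> 1 / real n" using n by (simp add: field_simps)
    then have "((2 * K) ^ k * (real d)\<^sup>2) * ((real n)\<^sup>2 / real n ^ k) \<le> ((2 * K) ^ k * (real d)\<^sup>2) * (1 / real n)"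
      using K by (intro mult_left_mono) auto
    then show ?thesis by (simp add: T'_eq D_def)
  qed
  have \<eta>: "\<eta> \<le> 2 * (K * s) + 4 * (K ^ 3 * (s * s)) + T'"
  proof -
    have "K * (real d / real L) \<le> K * (2 * s)" using dL K by (intro mult_left_mono) auto
    then show ?thesis by (simp add: \<eta>_def T'_def K_def ss)
  qed
  then have \<eta>2: "\<eta> \<le> 1 / 2" using K3ss Ks T'8 by linarith
  \<comment> \<open>Smallness of \<open>s\<close> makes \<open>n\<close> large compared with
    \<open>d\<close>: from s R = d follows 32 K d \<le> R, and R \<le> R^2 = n d.\<close>
  have big: "4 * k \<le> n * d"
  proof -
    have "32 * (K * s) * R \<le> 1 * R" using Ks(1) R1 by (intro mult_right_mono) auto
    also have "32 * (K * s) * R = 32 * (K * (s * R))" by simp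
    finally have "32 * (K * real d) \<le> R" unfolding sR by simp
    moreover have "K * 1 \<le> K * real d" using K d by (intro mult_left_mono) auto
    moreover have "R * 1 \<le> R * R" using R1 by (intro mult_left_mono) auto
    ultimately have "4 * K \<le> real n * real d" using RR K by linarith
    then have "real (4 * k) \<le> real (n * d)" by (simp add: K_def)
    then show ?thesis by (rule of_nat_le_iff[THEN iffD1])
  qed
  have xL2: "x / real L \<le> 1 / 2" using xL Ks by linarith
  note est = ln_simple_probability[OF n L(3) big, of B, folded x_def \<eta>_def \<beta>_def, OF _ \<eta>2 \<beta>4 xL2]
  show "0 < simple_probability" using est(1) by (simp add: B_def)
  have \<eta>_le: "\<eta> \<le> 2 * (K * s) + 4 * (K ^ 3 * s) + (2 * K) ^ k * D"
    by (intro order.trans[OF \<eta>] add_mono mult_left_mono K3ss T'D order.refl) auto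
  have "\<bar>ln simple_probability + x\<bar> \<le> 2 * \<eta> + 4 * (x * \<beta>) + 2 * (x / real L)"
    using est(2) by (simp add: B_def)
  also have "\<dots> \<le> 2 * (2 * (K * s) + 4 * (K ^ 3 * s) + (2 * K) ^ k * D) + 4 * (2 * K\<^sup>2 * s + K ^ 4 * D) + 2 * (K * s)"
    by (intro add_mono mult_left_mono \<eta>_le x\<beta> xL) auto
  also have "\<dots> = (6 * K + 8 * K ^ 3 + 8 * K\<^sup>2) * s + (2 * (2 * K) ^ k + 4 * K ^ 4) * D"
    by (simp add: algebra_simps)
  \<comment> \<open>A common, generous constant for both terms lets the sum of \<open>s\<close> and
    \<open>D\<close> be factored out.\<close>
  also have "\<dots> \<le> (10 * K + 8 * K ^ 3 + 2 * (2 * K) ^ k + 8 * K\<^sup>2 + 4 * K ^ 4) * s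
      + (10 * K + 8 * K ^ 3 + 2 * (2 * K) ^ k + 8 * K\<^sup>2 + 4 * K ^ 4) * D"
  proof (intro add_mono[OF mult_right_mono mult_right_mono] \<open>0 \<le> s\<close> D0)
    have "0 \<le> K" "0 \<le> K ^ 3" "0 \<le> (2 * K) ^ k" "0 \<le> K\<^sup>2" "0 \<le> K ^ 4" using K by auto
    then show "6 * K + 8 * K ^ 3 + 8 * K\<^sup>2 \<le> 10 * K + 8 * K ^ 3 + 2 * (2 * K) ^ k + 8 * K\<^sup>2 + 4 * K ^ 4"
      and "2 * (2 * K) ^ k + 4 * K ^ 4 \<le> 10 * K + 8 * K ^ 3 + 2 * (2 * K) ^ k + 8 * K\<^sup>2 + 4 * K ^ 4"
      by linarith+
  qed
  finally show "\<bar>ln simple_probability + (real k - 1) * (real d - 1) / 2\<bar>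
      \<le> (10 * real k + 8 * real k ^ 3 + 2 * (2 * real k) ^ k + 8 * real k ^ 2 + 4 * real k ^ 4)
        * (s + (real d)\<^sup>2 / real n)"
    by (simp add: x_def K_def D_def distrib_left)
qed

end

section \<open>The asymptotic formula along the admissible n\<close>

theorem theorem1:
  fixes k :: nat and d :: "nat \<Rightarrow> nat"
  assumes "k \<ge> 3"
    and "\<forall>\<^sub>F n in admissible_at_top k d. 1 \<le> d n"
    and "(\<lambda>n. real (d n)) \<in> o[admissible_at_top k d](\<lambda>n. real n powr kappa k)"
  shows "\<exists>\<epsilon> :: nat \<Rightarrow> real.
    \<epsilon> \<in> O[admissible_at_top k d](\<lambda>n. sqrt (real (d n) / real n) + (real (d n))\<^sup>2 / real n) \<and>
    (\<forall>\<^sub>F n in admissible_at_top k d.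
       real (card (regular_hypergraphs k n (d n))) =
         fact (n * d n) /
           (fact (n * d n div k) * fact k ^ (n * d n div k) * fact (d n) ^ n) *
         exp (- (1/2) * (real k - 1) * (real (d n) - 1) + \<epsilon> n))"
proof -
  let ?F = "admissible_at_top k d"
  define C where "C = 10 * real k + 8 * real k ^ 3 + 2 * (2 * real k) ^ k + 8 * real k ^ 2 + 4 * real k ^ 4"
  define p where "p n = configuration.simple_probability n (d n) k (n * d n div k)" for n
  \<comment> \<open>This choice makes the formula exact wherever \<open>p n\<close> is positive; all
    the content lies in its bound.\<close>
  define \<epsilon> where "\<epsilon> n = ln (p n) + (real k - 1) * (real (d n) - 1) / 2" for n
  \<comment> \<open>The last two entries provide the two smallness hypotheses of
    \<open>simple_probability_estimate\<close>; the first gives c^2 \<le> c.\<close>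
  define c where "c = min 1 (min ((1 / (32 * real k ^ 3))\<^sup>2) (1 / (8 * (2 * real k) ^ k)))"
  have k: "0 < real k" using assms(1) by simp
  have c: "0 < c" "c \<le> 1" "c \<le> (1 / (32 * real k ^ 3))\<^sup>2" "c \<le> 1 / (8 * (2 * real k) ^ k)"
    using k by (auto simp: c_def)
  have sqrt_c: "sqrt c \<le> 1 / (32 * real k ^ 3)"
    using c(3) k by (intro real_le_lsqrt) auto
  have small_c: "(2 * real k) ^ k * c \<le> 1 / 8"
    using c(4) k by (simp add: field_simps)
  have dvd: "\<forall>\<^sub>F n in ?F. k dvd n * d n"
    unfolding admissible_at_top_def eventually_inf_principal by simp
  have pos: "\<forall>\<^sub>F n in ?F. 0 < n"
    unfolding admissible_at_top_def eventually_inf_principal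
    using eventually_gt_at_top[of "0::nat"] by eventually_elim simp
  have small: "\<forall>\<^sub>F n in ?F. norm (real (d n)) \<le> c * norm (real n powr kappa k)"
    using assms(3) c(1) by (rule landau_o.smallD)
  have main: "\<forall>\<^sub>F n in ?F. 0 < p n \<and>
      real (card (regular_hypergraphs k n (d n))) =
        fact (n * d n) / (fact (n * d n div k) * fact k ^ (n * d n div k) * fact (d n) ^ n) * p n \<and>
      \<bar>\<epsilon> n\<bar> \<le> C * (sqrt (real (d n) / real n) + (real (d n))\<^sup>2 / real n)"
    using dvd pos small assms(2)
  proof eventually_elim
    case (elim n)
    interpret configuration n "d n" k "n * d n div k"
      by unfold_locales (use assms(1) elim(1,4) in auto)
    have n1: "1 \<le> real n" using elim(2) by simp
    have dn: "real (d n) \<le> c * real n powr kappa k" using elim(3) by simp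
    have "real n powr kappa k \<le> real n powr 1"
      using n1 by (intro powr_mono) (auto simp: kappa_def)
    then have "c * real n powr kappa k \<le> c * real n" using c(1) n1 by (intro mult_left_mono) auto
    then have "real (d n) / real n \<le> c" using dn n1 by (simp add: field_simps)
    then have s: "sqrt (real (d n) / real n) \<le> 1 / (32 * real k ^ 3)"
      using sqrt_c real_sqrt_le_mono order.trans by blast
    \<comment> \<open>This is the inequality 2 \<kappa> + 2 \<le> k, an equality for k = 3 and k =
      4.\<close>
    have "(real n powr kappa k)\<^sup>2 * (real n)\<^sup>2 \<le> real n ^ k"
    proof -
      have "(real n powr kappa k)\<^sup>2 * (real n)\<^sup>2 = real n powr (kappa k + kappa k) * real n powr 2"
        unfolding powr_add using n1 by (simp add: power2_eq_square)
      also have "\<dots> = real n powr (2 * kappa k + 2)"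
        by (simp only: powr_add[symmetric] mult_2)
      also have "\<dots> \<le> real n powr real k"
        using n1 assms(1) by (intro powr_mono) (auto simp: kappa_def)
      finally show ?thesis using n1 by (simp add: powr_realpow)
    qed
    then have "c\<^sup>2 * ((real n powr kappa k)\<^sup>2 * (real n)\<^sup>2) \<le> c * real n ^ k"
      using c n1 by (intro mult_mono) (auto simp: power2_eq_square mult_left_le)
    moreover have "(real (d n))\<^sup>2 * (real n)\<^sup>2 \<le> (c * real n powr kappa k)\<^sup>2 * (real n)\<^sup>2"
      using dn by (intro mult_right_mono power_mono) auto
    ultimately have "(real (d n))\<^sup>2 * (real n)\<^sup>2 \<le> c * real n ^ k"
      by (simp add: power_mult_distrib mult_ac)
    then have "(real (d n))\<^sup>2 * (real n)\<^sup>2 / real n ^ k \<le> c" using n1 by (simp add: field_simps)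
    then have T': "(2 * real k) ^ k * ((real (d n))\<^sup>2 * (real n)\<^sup>2 / real n ^ k) \<le> (2 * real k) ^ k * c"
      by (intro mult_left_mono) auto
    have "(2 * real k) ^ k * (real (d n))\<^sup>2 * (real n)\<^sup>2 / real n ^ k =
        (2 * real k) ^ k * ((real (d n))\<^sup>2 * (real n)\<^sup>2 / real n ^ k)" by simp
    also have "\<dots> \<le> 1 / 8" using T' small_c by (rule order.trans)
    finally have T: "(2 * real k) ^ k * (real (d n))\<^sup>2 * (real n)\<^sup>2 / real n ^ k \<le> 1 / 8" .
    show ?case
      using simple_probability_estimate[OF elim(2) s T] card_regular_hypergraphs
      by (simp add: p_def \<epsilon>_def C_def)
  qed
  show ?thesis
  proof (intro exI[of _ \<epsilon>] conjI)
    show "\<epsilon> \<in> O[?F](\<lambda>n. sqrt (real (d n) / real n) + (real (d n))\<^sup>2 / real n)"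
    proof (rule bigoI[of _ C])
      show "\<forall>\<^sub>F n in ?F. norm (\<epsilon> n) \<le> C * norm (sqrt (real (d n) / real n) + (real (d n))\<^sup>2 / real n)"
        using main by eventually_elim simp
    qed
    show "\<forall>\<^sub>F n in ?F. real (card (regular_hypergraphs k n (d n))) =
         fact (n * d n) /
           (fact (n * d n div k) * fact k ^ (n * d n div k) * fact (d n) ^ n) *
         exp (- (1/2) * (real k - 1) * (real (d n) - 1) + \<epsilon> n)"
      using main
    proof eventually_elim
      case (elim n)
      have "- (1/2) * (real k - 1) * (real (d n) - 1) + \<epsilon> n = ln (p n)"
        by (simp add: \<epsilon>_def)
      then show ?case using elim by simp
    qed
  qed
qed

end
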